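(* Let $G$ be a group with finite inverse-closed generating set $\Sigma$. For each $n\in\mathbb{N}$, the Cayley graph $\mathrm{Cay}(G,\Sigma)$ is geodetic if and only if the Cayley graph $\mathrm{Cay}(\mathcal{G}_n(G,\Sigma),\Sigma(n))$ is geodetic.
   Context: $\mathbb{N}$ includes $0$. For $a\le b$ integers, $[a,b]$ denotes the set of integers $k$ with $a\le k\le b$. **Graphs.** Graphs are simple and undirected. A path of length $k$ is a sequence of vertices $(v_0,\dots,v_k)$ with consecutive vertices adjacent; $|p|$ is the length of $p$, and $p^{-1}$ is the reverse path. A connected graph is geodetic if for each pair of vertices there is a unique shortest path between them. A circuit is a path whose initial and terminal vertices agree; it is embedded if it has length at least $3$ and its only repeated vertices are the initial and terminal one. An $X$-labelled graph has a function $L$ assigning an element of $X$ to each ordered pair $(u,v)$ of adjacent vertices; the label of $(v_0,\dots,v_k)$ is the word $L(v_0,v_1)\cdots L(v_{k-1},v_k)$, and a path of length $0$ has label the empty word $\lambda$. **Cayley graphs.** A finite inverse-closed generating set $\Sigma$ of $G$ is a finite generating set with $1_G\notin\Sigma$ and $\Sigma=\Sigma^{-1}$. $\mathrm{Cay}(G,\Sigma)$ is the $\Sigma$-labelled graph with vertex set $G$, edges $\{g,h\}$ with $g^{-1}h\in\Sigma$, and $L(g,h)=g^{-1}h$. **Rewriting systems.** A rewriting system is a pair $(A,T)$ with $A$ a finite alphabet and $T\subseteq A^*\times A^*$. Write $u\ell v\to urv$ for $(\ell,r)\in T$, $u,v\in A^*$; $\overset{*}{\leftrightarrow}$ is the equivalence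 relation generated by $\to$. $M(A,T)$ is the monoid of $\overset{*}{\leftrightarrow}$-classes under concatenation. **The construction $\nabla_n(G,\Sigma)$.** Let $\Gamma=\mathrm{Cay}(G,\Sigma)$ with labelling $L$. Let $\Sigma_1=\{a_1,\dots,a_{m_1}\}$ be the set of elements of order two in $\Sigma$, and partition $\Sigma\setminus\Sigma_1$ as $\Sigma_2\sqcup\Sigma_3$ with $\Sigma_2=\{b_1,\dots,b_{m_2}\}$, $\Sigma_3=\{c_1,\dots,c_{m_2}\}$, $c_i=b_i^{-1}$ in $G$. Let $\Sigma(n)$ be the set of distinct symbols $a_{i,j}$ ($i\in[1,m_1]$, $j\in[1,2n+1]$), $b_{i,j}$ and $c_{i,j}$ ($i\in[1,m_2]$, $j\in[1,2n+1]$). Let $\Gamma_n$ be the graph obtained from $\Gamma$ by subdividing each edge into $2n+1$ edges, with the $\Sigma(n)$-labelling such that, for each edge $\{g,h\}$ of $\Gamma$: if $L(g,h)=x_i\in\Sigma_1\cup\Sigma_2$ (with $x\in\{a,b\}$), the subdivided path from $g$ to $h$ is labelled $x_{i,1}x_{i,2}\cdots x_{i,2n+1}$; if $L(g,h)=c_i\in\Sigma_3$, the subdivided path from $g$ to $h$ is labelled $c_{i,2n+1}c_{i,2n}\cdots c_{i,1}$. Fix a total order on $\Sigma(n)$ and the induced shortlex order on $\Sigma(n)^*$ (compare lengths first, then lexicographically). A path in $\Gamma_n$ is called $\Gamma_n$-slex if its label is shortlex-least among the labels of all paths in $\Gamma_n$ with the same initial and terminal vertices. The set $T(n)\subset\Sigma(n)^*\times\Sigma(n)^*$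 consists of all pairs $(\ell,r)$ such that one of the following holds: - $(\mathcal{R}_1)$ $\ell$ is the label of a path $(u,v,u)$ with $u,v$ adjacent vertices of $\Gamma_n$, and $r=\lambda$; - $(\mathcal{R}_2)$ $\ell$ is the label of a path $\alpha$ and $r$ the label of a path $\beta$ in $\Gamma_n$, $\alpha\beta^{-1}$ is an embedded circuit of odd length, $|\alpha|=|\beta|+1$, and $\beta$ is $\Gamma_n$-slex; - $(\mathcal{R}_3)$ $\ell$ is the label of a path $\alpha$ and $r$ the label of a path $\beta$ in $\Gamma_n$, $\alpha\beta^{-1}$ is an embedded circuit of length at least $4$, $|\alpha|=|\beta|$, and $\beta$ is $\Gamma_n$-slex. Then $\nabla_n(G,\Sigma)=(\Sigma(n),T(n))$ and $\mathcal{G}_n(G,\Sigma)=M(\Sigma(n),T(n))$. The monoid $\mathcal{G}_n(G,\Sigma)$ is a group with finite inverse-closed generating set $\Sigma(n)$ (letters being identified with the elements they represent). *)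

theory Defs
  imports
    "HOL-Algebra.Generated_Groups"
    "HOL-Algebra.Multiplicative_Group"
    "Graph_Theory.Graph_Theory"
begin

text \<open>
  A simple undirected graph, possibly infinite, is a \<open>pair_pre_digraph\<close> whose arc relation is
  symmetric and irreflexive (locale \<open>pair_bidirected_digraph\<close>).  A path is a \<open>vwalk\<close>, that is, a
  nonempty list of vertices in which consecutive vertices are adjacent; vertices may repeat.
\<close>

definition path_between :: "'v pair_pre_digraph \<Rightarrow> 'v \<Rightarrow> 'v \<Rightarrow> 'v list \<Rightarrow> bool" where
  "path_between X u v p \<longleftrightarrow> vwalk p (with_proj X) \<and> hd p = u \<and> last p = v"

definition shortest_path :: "'v pair_pre_digraph \<Rightarrow> 'v \<Rightarrow> 'v \<Rightarrow> 'v list \<Rightarrow> bool" where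
  "shortest_path X u v p \<longleftrightarrow>
     path_between X u v p \<and> (\<forall>q. path_between X u v q \<longrightarrow> vwalk_length p \<le> vwalk_length q)"

definition geodetic :: "'v pair_pre_digraph \<Rightarrow> bool" where
  "geodetic X \<longleftrightarrow>
     Digraph_Component.connected (with_proj X) \<and>
     (\<forall>u\<in>pverts X. \<forall>v\<in>pverts X. \<exists>!p. shortest_path X u v p)"

definition embedded_circuit :: "'v pair_pre_digraph \<Rightarrow> 'v list \<Rightarrow> bool" where
  "embedded_circuit X c \<longleftrightarrow>
     vwalk c (with_proj X) \<and> hd c = last c \<and> 3 \<le> vwalk_length c \<and> distinct (tl c)"

definition path_label :: "('v \<Rightarrow> 'v \<Rightarrow> 'x) \<Rightarrow> 'v list \<Rightarrow> 'x list" where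
  "path_label L p = map (\<lambda>(u, v). L u v) (vwalk_arcs p)"

text \<open>A total order \<open>r\<close> on the letters is reflexive, whereas \<open>lenlex\<close> takes a strict order.\<close>

definition slex :: "'v pair_pre_digraph \<Rightarrow> ('v \<Rightarrow> 'v \<Rightarrow> 'x) \<Rightarrow> 'x rel \<Rightarrow> 'v list \<Rightarrow> bool" where
  "slex X L r p \<longleftrightarrow>
     vwalk p (with_proj X) \<and>
     (\<forall>q. path_between X (hd p) (last p) q \<longrightarrow>
        path_label L p = path_label L q \<or> (path_label L p, path_label L q) \<in> lenlex (r - Id))"

definition finite_inverse_closed_generating_set :: "('a, 'b) monoid_scheme \<Rightarrow> 'a set \<Rightarrow> bool" where
  "finite_inverse_closed_generating_set G S \<longleftrightarrow>
     finite S \<and> S \<subseteq> carrier G \<and> generate G S = carrier G \<and> \<one>\<^bsub>G\<^esub> \<notin> S \<and> m_inv G ` S = S"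

definition cayley_label :: "('a, 'b) monoid_scheme \<Rightarrow> 'a \<Rightarrow> 'a \<Rightarrow> 'a" where
  "cayley_label G g h = inv\<^bsub>G\<^esub> g \<otimes>\<^bsub>G\<^esub> h"

definition cayley_graph :: "('a, 'b) monoid_scheme \<Rightarrow> 'a set \<Rightarrow> 'a pair_pre_digraph" where
  "cayley_graph G S =
     \<lparr> pverts = carrier G,
       parcs = {(g, h). g \<in> carrier G \<and> h \<in> carrier G \<and> cayley_label G g h \<in> S} \<rparr>"

lemma pair_bidirected_cayley_graph:
  assumes "group G" "finite_inverse_closed_generating_set G S"
  shows "pair_bidirected_digraph (cayley_graph G S)"
proof -
  interpret group G by fact
  have one: "\<one>\<^bsub>G\<^esub> \<notin> S" and inv: "m_inv G ` S = S"
    using assms(2) by (auto simp: finite_inverse_closed_generating_set_def)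
  have flip: "cayley_label G h g \<in> S"
    if "cayley_label G g h \<in> S" "g \<in> carrier G" "h \<in> carrier G" for g h
  proof -
    have "inv\<^bsub>G\<^esub> (cayley_label G g h) \<in> S"
      using that(1) inv by blast
    then show ?thesis
      using that(2,3) by (simp add: cayley_label_def inv_mult_group)
  qed
  show ?thesis
    by unfold_locales
      (auto simp: cayley_graph_def symmetric_def sym_def flip, use one in \<open>simp add: cayley_label_def\<close>)
qed

text \<open>
  \<open>sd_point m g h k\<close> is the vertex at distance \<open>k\<close> from \<open>g\<close> on the path of length \<open>m\<close> replacing the
  edge between \<open>g\<close> and \<open>h\<close>.  The same vertex is at distance \<open>m - k\<close> from \<open>h\<close>, so an interior vertex
  is encoded as the set of its two descriptions.
\<close>

datatype 'a sd_vertex = Orig 'a | Mid "('a \<times> 'a \<times> nat) set"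

definition sd_point :: "nat \<Rightarrow> 'a \<Rightarrow> 'a \<Rightarrow> nat \<Rightarrow> 'a sd_vertex" where
  "sd_point m g h k =
     (if k = 0 then Orig g else if k = m then Orig h else Mid {(g, h, k), (h, g, m - k)})"

definition subdivided_graph :: "nat \<Rightarrow> 'a pair_pre_digraph \<Rightarrow> 'a sd_vertex pair_pre_digraph" where
  "subdivided_graph m X =
     \<lparr> pverts = Orig ` pverts X \<union> {sd_point m g h k | g h k. (g, h) \<in> parcs X \<and> k \<le> m},
       parcs = {(sd_point m g h k, sd_point m g h (Suc k)) | g h k. (g, h) \<in> parcs X \<and> k < m} \<rparr>"

text \<open>
  Given for each arc \<open>(g, h)\<close> the word \<open>w g h\<close> of length \<open>m\<close> to be read from \<open>g\<close> to \<open>h\<close>, this is the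
  resulting labelling of the subdivided graph.  The description below is unique by \<open>sd_arc_unique\<close>.
\<close>

definition sd_label ::
    "nat \<Rightarrow> 'a pair_pre_digraph \<Rightarrow> ('a \<Rightarrow> 'a \<Rightarrow> 'x list) \<Rightarrow> 'a sd_vertex \<Rightarrow> 'a sd_vertex \<Rightarrow> 'x" where
  "sd_label m X w p q =
     (THE x. \<exists>g h k. (g, h) \<in> parcs X \<and> k < m \<and>
        p = sd_point m g h k \<and> q = sd_point m g h (Suc k) \<and> x = w g h ! k)"

lemma sd_point_flip: "k \<le> m \<Longrightarrow> 0 < m \<Longrightarrow> sd_point m h g (m - k) = sd_point m g h k"
  by (auto simp: sd_point_def)

lemma sd_point_eqD:
  assumes "g \<noteq> h" "k \<le> m" "k' \<le> m" "sd_point m g h k = sd_point m g' h' k'" "0 < k" "k < m"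
  shows "0 < k' \<and> k' < m \<and> (g = g' \<and> h = h' \<and> k = k' \<or> g = h' \<and> h = g' \<and> k + k' = m)"
  using assms
  by (auto simp add: sd_point_def doubleton_eq_iff split: if_splits)

lemma sd_arc_unique:
  assumes "g \<noteq> h" "k < m" "k' < m"
    and "sd_point m g h k = sd_point m g' h' k'"
    and "sd_point m g h (Suc k) = sd_point m g' h' (Suc k')"
  shows "g = g' \<and> h = h' \<and> k = k'"
proof (cases "m = 1")
  case True
  then show ?thesis using assms by (simp add: sd_point_def)
next
  case False
  note 1 = sd_point_eqD[OF assms(1) _ _ assms(4)] sd_point_eqD[OF assms(1) _ _ assms(5)]
  show ?thesis
  proof (cases "k = 0")
    case True
    with 1(2) False assms(2,3) have "g = g' \<and> h = h' \<and> k = k' \<or> g = h' \<and> h = g' \<and> Suc k + Suc k' = m"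
      by auto
    moreover have "g = g'" if "g = h'" 
      using assms(4) True that assms(3) by (auto simp: sd_point_def split: if_splits)
    ultimately show ?thesis using assms(1) by auto
  next
    case k: False
    with 1(1) assms(2,3) have a: "g = g' \<and> h = h' \<and> k = k' \<or> g = h' \<and> h = g' \<and> k + k' = m"
      by auto
    show ?thesis
    proof (cases "Suc k = m")
      case True
      then show ?thesis using a assms(1,3,5) k by (auto simp: sd_point_def split: if_splits)
    next
      case Sk: False
      with 1(2) assms(2,3) have "g = g' \<and> h = h' \<and> k = k' \<or> g = h' \<and> h = g' \<and> Suc k + Suc k' = m"
        by auto
      with a assms(1) show ?thesis by auto
    qed
  qed
qed

lemma sd_point_Suc_neq:
  assumes "g \<noteq> h" "k < m"
  shows "sd_point m g h k \<noteq> sd_point m g h (Suc k)"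
  using assms by (auto simp: sd_point_def doubleton_eq_iff split: if_splits)

lemma sd_label_sd_point:
  assumes "pair_bidirected_digraph X" "(g, h) \<in> parcs X" "k < m"
  shows "sd_label m X w (sd_point m g h k) (sd_point m g h (Suc k)) = w g h ! k"
proof -
  interpret pair_bidirected_digraph X by fact
  have "g \<noteq> h"
    using pair_no_loops[OF assms(2)] by simp
  then show ?thesis
    unfolding sd_label_def
    using assms sd_arc_unique[OF \<open>g \<noteq> h\<close> assms(3)]
    by (intro the_equality) (blast, metis)
qed

lemma pair_bidirected_subdivided_graph:
  assumes "pair_bidirected_digraph X"
  shows "pair_bidirected_digraph (subdivided_graph m X)"
proof -
  interpret X: pair_bidirected_digraph X by fact
  have X_sym: "(h, g) \<in> parcs X" if "(g, h) \<in> parcs X" for g h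
    using X.pair_sym_arcs that by (auto simp: symmetric_def sym_def)
  have flip: "(sd_point m g h (Suc k), sd_point m g h k) \<in> parcs (subdivided_graph m X)"
    if "(g, h) \<in> parcs X" "k < m" for g h k
  proof -
    have "sd_point m g h (Suc k) = sd_point m h g (m - Suc k)"
         "sd_point m g h k = sd_point m h g (Suc (m - Suc k))"
      using that sd_point_flip[of "Suc k" m h g] sd_point_flip[of k m h g] by (auto simp: Suc_diff_Suc)
    then show ?thesis
      using X_sym[OF that(1)] that(2) by (auto simp: subdivided_graph_def) (metis diff_Suc_less gr_implies_not0 not_gr0)
  qed
  show ?thesis
  proof unfold_locales
    show "symmetric (with_proj (subdivided_graph m X))"
      unfolding symmetric_def sym_def using flip by (auto simp: subdivided_graph_def)
  next
    fix e assume "e \<in> parcs (subdivided_graph m X)"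
    then obtain g h k where e: "(g, h) \<in> parcs X" "k < m"
        "e = (sd_point m g h k, sd_point m g h (Suc k))"
      by (auto simp: subdivided_graph_def)
    have "sd_point m g h j \<in> pverts (subdivided_graph m X)" if "j \<le> m" for j
      using e(1) that unfolding subdivided_graph_def by auto
    from this[of k] this[of "Suc k"] e
    show "fst e \<in> pverts (subdivided_graph m X)" "snd e \<in> pverts (subdivided_graph m X)"
      by auto
    show "fst e \<noteq> snd e"
      using sd_point_Suc_neq[of g h k m] X.pair_no_loops[OF e(1)] e by simp
  qed
qed

text \<open>A rewriting system is a pair \<open>(A, T)\<close> of an alphabet and a set of rules over it.\<close>

type_synonym 'x rewriting_system = "'x set \<times> ('x list \<times> 'x list) set"

definition rewrite_step :: "'x rewriting_system \<Rightarrow> 'x list \<Rightarrow> 'x list \<Rightarrow> bool" where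
  "rewrite_step = (\<lambda>(A, T) s t.
     \<exists>u v l r. (l, r) \<in> T \<and> u \<in> lists A \<and> v \<in> lists A \<and> s = u @ l @ v \<and> t = u @ r @ v)"

definition rewrite_equiv :: "'x rewriting_system \<Rightarrow> 'x list rel" where
  "rewrite_equiv R =
     {(s, t). s \<in> lists (fst R) \<and> t \<in> lists (fst R) \<and> equivclp (rewrite_step R) s t}"

definition rewriting_monoid :: "'x rewriting_system \<Rightarrow> 'x list set monoid" where
  "rewriting_monoid R =
     \<lparr> carrier = lists (fst R) // rewrite_equiv R,
       monoid.mult = (\<lambda>U V. \<Union>s\<in>U. \<Union>t\<in>V. rewrite_equiv R `` {s @ t}),
       monoid.one = rewrite_equiv R `` {[]} \<rparr>"

definition rewriting_letters :: "'x rewriting_system \<Rightarrow> 'x list set set" where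
  "rewriting_letters R = (\<lambda>x. rewrite_equiv R `` {[x]}) ` fst R"

definition order_two :: "('a, 'b) monoid_scheme \<Rightarrow> 'a set \<Rightarrow> 'a set" where
  "order_two G S = {s \<in> S. group.ord G s = 2}"

definition inverse_pair_partition ::
    "('a, 'b) monoid_scheme \<Rightarrow> 'a set \<Rightarrow> 'a set \<Rightarrow> 'a set \<Rightarrow> bool" where
  "inverse_pair_partition G S S2 S3 \<longleftrightarrow>
     S - order_two G S = S2 \<union> S3 \<and> S2 \<inter> S3 = {} \<and> S3 = m_inv G ` S2"

text \<open>The symbol \<open>x\<^bsub>i,j\<^esub>\<close> is represented by the pair \<open>(x\<^sub>i, j)\<close>.\<close>

definition nabla_alphabet :: "'a set \<Rightarrow> nat \<Rightarrow> ('a \<times> nat) set" where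
  "nabla_alphabet S n = S \<times> {1..2 * n + 1}"

definition edge_word :: "'a set \<Rightarrow> nat \<Rightarrow> 'a \<Rightarrow> ('a \<times> nat) list" where
  "edge_word S3 n s =
     (let w = map (Pair s) [1..<2 * n + 2] in if s \<in> S3 then rev w else w)"

definition nabla_graph :: "('a, 'b) monoid_scheme \<Rightarrow> 'a set \<Rightarrow> nat \<Rightarrow> 'a sd_vertex pair_pre_digraph" where
  "nabla_graph G S n = subdivided_graph (2 * n + 1) (cayley_graph G S)"

definition nabla_label ::
    "('a, 'b) monoid_scheme \<Rightarrow> 'a set \<Rightarrow> 'a set \<Rightarrow> nat \<Rightarrow> 'a sd_vertex \<Rightarrow> 'a sd_vertex \<Rightarrow> 'a \<times> nat" where
  "nabla_label G S S3 n =
     sd_label (2 * n + 1) (cayley_graph G S) (\<lambda>g h. edge_word S3 n (cayley_label G g h))"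

text \<open>
  The conditions on \<open>hd\<close> and \<open>last\<close> say that the path \<open>\<alpha>\<close> followed by the reverse of \<open>\<beta>\<close> is defined
  and closed.
\<close>

definition nabla_rules ::
    "('a, 'b) monoid_scheme \<Rightarrow> 'a set \<Rightarrow> 'a set \<Rightarrow> ('a \<times> nat) rel \<Rightarrow> nat \<Rightarrow>
     (('a \<times> nat) list \<times> ('a \<times> nat) list) set" where
  "nabla_rules G S S3 r n =
     (let X = nabla_graph G S n; L = nabla_label G S S3 n in
        {(path_label L [u, v, u], []) | u v. (u, v) \<in> parcs X}
      \<union> {(path_label L \<alpha>, path_label L \<beta>) | \<alpha> \<beta>.
            vwalk \<alpha> (with_proj X) \<and> vwalk \<beta> (with_proj X) \<and> hd \<alpha> = hd \<beta> \<and> last \<alpha> = last \<beta> \<and>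
            embedded_circuit X (vwalk_join \<alpha> (rev \<beta>)) \<and>
            odd (vwalk_length (vwalk_join \<alpha> (rev \<beta>))) \<and>
            vwalk_length \<alpha> = vwalk_length \<beta> + 1 \<and> slex X L r \<beta>}
      \<union> {(path_label L \<alpha>, path_label L \<beta>) | \<alpha> \<beta>.
            vwalk \<alpha> (with_proj X) \<and> vwalk \<beta> (with_proj X) \<and> hd \<alpha> = hd \<beta> \<and> last \<alpha> = last \<beta> \<and>
            embedded_circuit X (vwalk_join \<alpha> (rev \<beta>)) \<and>
            4 \<le> vwalk_length (vwalk_join \<alpha> (rev \<beta>)) \<and>
            vwalk_length \<alpha> = vwalk_length \<beta> \<and> slex X L r \<beta>})"

definition nabla ::
    "('a, 'b) monoid_scheme \<Rightarrow> 'a set \<Rightarrow> 'a set \<Rightarrow> ('a \<times> nat) rel \<Rightarrow> nat \<Rightarrow> ('a \<times> nat) rewriting_system" where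
  "nabla G S S3 r n = (nabla_alphabet S n, nabla_rules G S S3 r n)"

end

theory Submission
  imports Defs
begin

text \<open>
  Let \<open>\<Gamma>\<close> be the Cayley graph of \<open>G\<close>, let \<open>Y\<close> be its subdivision into \<open>2n + 1\<close> parts per edge, and let
  \<open>M\<close> be the presented group.  The theorem is the composite of two equivalences, \<open>\<Gamma>\<close> geodetic iff \<open>Y\<close>
  geodetic and \<open>Y\<close> geodetic iff the Cayley graph of \<open>M\<close> geodetic.

  Both are proved in a local form of uniqueness.  Shortest paths are unique iff, seen from any root
  \<open>u\<close>, no vertex has two neighbours that are closer to \<open>u\<close> than itself
  (\<open>geodetic_iff_unique_predecessors\<close>).  In this form one only has to know the distance
  functions and to compare their values at neighbours.

  In \<open>Y\<close> the distance from \<open>x\<close> to a point of an edge not containing \<open>x\<close> is the smaller of the two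
  lengths obtained by going through either end (\<open>E_interior\<close>), and distances between original vertices
  are multiples of \<open>2n + 1\<close>.  A second predecessor in \<open>Y\<close> that is not already one in \<open>\<Gamma>\<close> can only come
  from a tie of two such lengths.  As \<open>2n + 1\<close> is odd, a tie forces two opposite pairs of ends to be
  equally far apart in \<open>\<Gamma>\<close> (\<open>odd_min_tie\<close>), and unique predecessors in \<open>\<Gamma>\<close> exclude that
  (\<open>opposite_edge_eq\<close>).

  For the second equivalence, think of the Cayley graph of \<open>M\<close> as a tree-like arrangement of copies of
  \<open>Y\<close>, glued along vertices; a shortest path is then a concatenation of shortest paths in the copies it
  runs through.  The algebra behind the picture is this.  \<open>G\<close> acts freely on \<open>Y\<close>, and the letters
  are the orbits of arcs.  Orbits of pairs \<open>(u, v)\<close> of vertices form a groupoid, in which the orbits of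
  \<open>(u, v)\<close> and \<open>(v, w)\<close> compose to that of \<open>(u, w)\<close>.  The rules say exactly that the label of a walk
  depends only on its ends (\<open>lbl_cong\<close>), so \<open>M\<close> is the universal group of this groupoid.
  Its elements have unique normal forms, sequences of nonidentity orbits no two consecutive members of
  which compose (\<open>cong_iff_nf\<close>).  The length of an element is the sum of the distances in
  \<open>Y\<close> of the members of its normal form (\<open>gdist_Cay\<close>).  A step towards the root changes only the
  last member, from the orbit of \<open>(u, v)\<close> to that of \<open>(u, y)\<close> with \<open>y\<close> a predecessor of \<open>v\<close> seen
  from \<open>u\<close> (\<open>nf_predecessor\<close>).  Hence predecessors are unique in one graph iff they are in the other.
\<close>

section \<open>Distances and unique predecessors\<close>

definition gdist :: "'v pair_pre_digraph \<Rightarrow> 'v \<Rightarrow> 'v \<Rightarrow> nat" where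
  "gdist X u v = (LEAST k. (u, v) \<in> parcs X ^^ k)"

definition unique_predecessors :: "'v pair_pre_digraph \<Rightarrow> bool" where
  "unique_predecessors X \<longleftrightarrow>
     (\<forall>u\<in>pverts X. \<forall>v w w'. (w, v) \<in> parcs X \<longrightarrow> (w', v) \<in> parcs X \<longrightarrow>
        gdist X u v = gdist X u w + 1 \<longrightarrow> gdist X u v = gdist X u w' + 1 \<longrightarrow> w = w')"

lemma unique_predecessorsD:
  "\<lbrakk>unique_predecessors X; u \<in> pverts X; (w, v) \<in> parcs X; (w', v) \<in> parcs X;
    gdist X u v = gdist X u w + 1; gdist X u v = gdist X u w' + 1\<rbrakk> \<Longrightarrow> w = w'"
  unfolding unique_predecessors_def by blast

lemma path_between_singleton: "path_between X u v [w] \<longleftrightarrow> w \<in> pverts X \<and> u = w \<and> v = w"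
  by (auto simp: path_between_def vwalk_def)

lemma path_between_snoc:
  assumes "pair_wf_digraph X" "p \<noteq> []"
  shows "path_between X u v (p @ [w]) \<longleftrightarrow> path_between X u (last p) p \<and> (last p, w) \<in> parcs X \<and> v = w"
  using assms pair_wf_digraph.in_arcsD2[OF assms(1)]
  by (auto simp: path_between_def vwalk_def set_vwalk_arcs_snoc)

lemma path_between_last: "path_between X u v p \<Longrightarrow> last p = v"
  by (simp add: path_between_def)

lemma path_between_imp_relpow:
  assumes "pair_wf_digraph X"
  shows "path_between X u v p \<Longrightarrow> (u, v) \<in> parcs X ^^ (length p - 1)"
proof (induction p arbitrary: v rule: rev_induct)
  case (snoc w p)
  show ?case
  proof (cases "p = []")
    case False
    then have "(u, last p) \<in> parcs X ^^ (length p - 1)" "(last p, v) \<in> parcs X"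
      using snoc path_between_snoc[OF assms False] by auto
    then have "(u, v) \<in> parcs X ^^ Suc (length p - 1)" by auto
    then show ?thesis using False by simp
  qed (use snoc in \<open>simp add: path_between_singleton\<close>)
qed (simp add: path_between_def vwalk_def)

lemma relpow_imp_path_between:
  assumes "pair_wf_digraph X" "u \<in> pverts X"
  shows "(u, v) \<in> parcs X ^^ k \<Longrightarrow> \<exists>p. path_between X u v p \<and> length p = Suc k"
proof (induction k arbitrary: v)
  case 0
  then have "path_between X u v [u]" using assms(2) by (simp add: path_between_singleton)
  then show ?case by fastforce
next
  case (Suc k)
  then obtain w where w: "(u, w) \<in> parcs X ^^ k" "(w, v) \<in> parcs X" by auto
  obtain p where p: "path_between X u w p" "length p = Suc k" using Suc.IH[OF w(1)] by blast
  have "p \<noteq> []" using p(2) by auto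
  then have "path_between X u v (p @ [v])"
    using path_between_snoc[OF assms(1)] p w by (metis path_between_last)
  then show ?case using p(2) by (intro exI[of _ "p @ [v]"]) simp
qed

locale connected_graph = pair_bidirected_digraph X for X :: "'v pair_pre_digraph" +
  assumes nonempty: "pverts X \<noteq> {}"
    and reach: "\<lbrakk>u \<in> pverts X; v \<in> pverts X\<rbrakk> \<Longrightarrow> (u, v) \<in> (parcs X)\<^sup>*"
begin

lemma arc_sym: "(u, v) \<in> parcs X \<Longrightarrow> (v, u) \<in> parcs X"
  using pair_sym_arcs by (auto simp: symmetric_def sym_def)

lemma arc_neq: "(u, v) \<in> parcs X \<Longrightarrow> u \<noteq> v"
  using pair_no_loops by fastforce

lemma gdist_le: "(u, v) \<in> parcs X ^^ k \<Longrightarrow> gdist X u v \<le> k"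
  unfolding gdist_def by (rule Least_le)

lemma relpow_gdist:
  assumes "u \<in> pverts X" "v \<in> pverts X"
  shows "(u, v) \<in> parcs X ^^ gdist X u v"
proof -
  obtain k where "(u, v) \<in> parcs X ^^ k"
    using reach[OF assms] by (auto simp: rtrancl_power)
  then show ?thesis unfolding gdist_def by (rule LeastI)
qed

lemma gdist_self [simp]: "gdist X u u = 0"
  using gdist_le[of u u 0] by simp

lemma relpow_arc_sym: "(u, v) \<in> parcs X ^^ k \<Longrightarrow> (v, u) \<in> parcs X ^^ k"
proof (induction k arbitrary: v)
  case (Suc k)
  then obtain w where "(u, w) \<in> parcs X ^^ k" "(w, v) \<in> parcs X" by auto
  then show ?case using Suc.IH arc_sym relpow_Suc_I2 by metis
qed simp

lemma gdist_commute: "gdist X u v = gdist X v u"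
proof -
  have "((u, v) \<in> parcs X ^^ k) = ((v, u) \<in> parcs X ^^ k)" for k
    using relpow_arc_sym by blast
  then show ?thesis by (simp add: gdist_def)
qed

lemma gdist_step:
  assumes "u \<in> pverts X" "(v, w) \<in> parcs X"
  shows "gdist X u w \<le> gdist X u v + 1"
proof -
  have "(u, v) \<in> parcs X ^^ gdist X u v" using assms by (auto intro: relpow_gdist in_arcsD1)
  then have "(u, w) \<in> parcs X ^^ Suc (gdist X u v)" using assms(2) by auto
  then show ?thesis using gdist_le by fastforce
qed

lemma gdist_pred:
  assumes "u \<in> pverts X" "v \<in> pverts X" "v \<noteq> u"
  obtains w where "(w, v) \<in> parcs X" "gdist X u v = gdist X u w + 1"
proof -
  have uv: "(u, v) \<in> parcs X ^^ gdist X u v" using assms by (simp add: relpow_gdist)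
  then obtain k where k: "gdist X u v = Suc k" using assms(3) by (cases "gdist X u v") auto
  with uv obtain w where w: "(u, w) \<in> parcs X ^^ k" "(w, v) \<in> parcs X" by auto
  have "gdist X u w \<le> k" using gdist_le w(1) .
  moreover have "Suc k \<le> gdist X u w + 1" using gdist_step[OF assms(1) w(2)] k by simp
  ultimately show thesis using that[OF w(2)] k by simp
qed

lemma gdist_eq_0: "\<lbrakk>u \<in> pverts X; v \<in> pverts X; gdist X u v = 0\<rbrakk> \<Longrightarrow> u = v"
  using relpow_gdist by fastforce

text \<open>
  A function that vanishes at \<open>u\<close>, grows by at most one along each arc and has somewhere to descend
  from every other vertex cannot differ from the distance: the growth bound gives one inequality along
  a shortest path, and the descent produces a path that gives the other one.  Distances are identified
  below by verifying these three properties.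
\<close>

lemma gdist_eqI:
  assumes u: "u \<in> pverts X" and d0: "d u = (0::nat)"
    and step: "\<And>v w. (v, w) \<in> parcs X \<Longrightarrow> d w \<le> d v + 1"
    and pred: "\<And>v. \<lbrakk>v \<in> pverts X; v \<noteq> u\<rbrakk> \<Longrightarrow> \<exists>w. (w, v) \<in> parcs X \<and> d v = d w + 1"
    and v: "v \<in> pverts X"
  shows "d v = gdist X u v"
proof (rule antisym)
  show "d v \<le> gdist X u v"
    using v
  proof (induction "gdist X u v" arbitrary: v)
    case 0
    then show ?case using d0 gdist_eq_0[OF u] by force
  next
    case (Suc k)
    then have "v \<noteq> u" by auto
    then obtain w where w: "(w, v) \<in> parcs X" "gdist X u v = gdist X u w + 1"
      using gdist_pred u Suc.prems by metis
    then show ?case using Suc.hyps(1)[of w] Suc.hyps(2) step[OF w(1)] in_arcsD1 by force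
  qed
  show "gdist X u v \<le> d v"
    using v
  proof (induction "d v" arbitrary: v rule: less_induct)
    case less
    show ?case
    proof (cases "v = u")
      case False
      then obtain w where w: "(w, v) \<in> parcs X" "d v = d w + 1" using pred less.prems by blast
      then show ?thesis using less.hyps[of w] gdist_step[OF u w(1)] in_arcsD1 by force
    qed simp
  qed
qed

lemma shortest_path_iff:
  assumes "u \<in> pverts X" "v \<in> pverts X"
  shows "shortest_path X u v p \<longleftrightarrow> path_between X u v p \<and> length p = Suc (gdist X u v)"
proof -
  have wf: "pair_wf_digraph X" ..
  have ge: "Suc (gdist X u v) \<le> length q" if "path_between X u v q" for q
  proof -
    have "q \<noteq> []" using that by (auto simp: path_between_def vwalk_def)
    then show ?thesis using gdist_le[OF path_between_imp_relpow[OF wf that]] by (cases q) auto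
  qed
  obtain q where q: "path_between X u v q" "length q = Suc (gdist X u v)"
    using relpow_imp_path_between[OF wf assms(1) relpow_gdist[OF assms]] by blast
  show ?thesis
  proof
    assume "shortest_path X u v p"
    then have "path_between X u v p" "length p - 1 \<le> length q - 1"
      using q(1) by (auto simp: shortest_path_def)
    then show "path_between X u v p \<and> length p = Suc (gdist X u v)"
      using ge[of p] q(2) by linarith
  next
    assume p: "path_between X u v p \<and> length p = Suc (gdist X u v)"
    have "length p - 1 \<le> length q' - 1" if "path_between X u v q'" for q'
      using p ge[OF that] by linarith
    then show "shortest_path X u v p" using p by (simp add: shortest_path_def)
  qed
qed

lemma connected_with_proj: "Digraph_Component.connected (with_proj X)"
proof -
  have "u \<rightarrow>\<^sup>*\<^bsub>with_proj X\<^esub> v" if "u \<in> pverts X" "v \<in> pverts X" for u v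
    using reach[OF that] that by (simp add: reachable_conv)
  then show ?thesis
    using nonempty reachable_mk_symmetric_eq[OF pair_sym_arcs]
    unfolding connected_def strongly_connected_def by simp
qed

text \<open>
  The last step of a shortest path starts at a predecessor of its end, and every shortest path to a
  predecessor extends to one to the end.  So two predecessors give two shortest paths, and conversely
  two shortest paths agree in their last step and, by induction, before it.
\<close>

lemma geodetic_iff_unique_predecessors: "geodetic X \<longleftrightarrow> unique_predecessors X"
proof
  have wf: "pair_wf_digraph X" ..
  have path: "\<exists>p. path_between X u v p \<and> length p = Suc (gdist X u v)"
    if "u \<in> pverts X" "v \<in> pverts X" for u v
    using relpow_imp_path_between[OF wf that(1) relpow_gdist[OF that]] .
  {
    assume geo: "geodetic X"
    show "unique_predecessors X"
      unfolding unique_predecessors_def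
    proof (intro ballI allI impI)
      fix u v w w'
      assume u: "u \<in> pverts X" and arcs: "(w, v) \<in> parcs X" "(w', v) \<in> parcs X"
        and d: "gdist X u v = gdist X u w + 1" "gdist X u v = gdist X u w' + 1"
      have v: "v \<in> pverts X" using arcs in_arcsD2 by blast
      have ex: "\<exists>p. shortest_path X u v (p @ [v]) \<and> last p = x"
        if x: "(x, v) \<in> parcs X" "gdist X u v = gdist X u x + 1" for x
      proof -
        obtain p where p: "path_between X u x p" "length p = Suc (gdist X u x)"
          using path[OF u in_arcsD1[OF x(1)]] by blast
        have "last p = x" "p \<noteq> []" using p path_between_last by fastforce+
        then have "shortest_path X u v (p @ [v])"
          using p x path_between_snoc[OF wf, of p u v v] by (simp add: shortest_path_iff[OF u v])
        then show ?thesis using \<open>last p = x\<close> by blast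
      qed
      obtain p where p: "shortest_path X u v (p @ [v])" "last p = w"
        using ex[OF arcs(1) d(1)] by blast
      obtain p' where p': "shortest_path X u v (p' @ [v])" "last p' = w'"
        using ex[OF arcs(2) d(2)] by blast
      have "p @ [v] = p' @ [v]"
        using geo u v p(1) p'(1) unfolding geodetic_def by blast
      then show "w = w'" using p(2) p'(2) by simp
    qed
  next
    assume up: "unique_predecessors X"
    have eq: "p = q" if "u \<in> pverts X" "path_between X u v p" "length p = Suc (gdist X u v)"
      "path_between X u v q" "length q = Suc (gdist X u v)" for u v p q
      using that
    proof (induction p arbitrary: q v rule: rev_induct)
      case (snoc a p)
      obtain q' b where q: "q = q' @ [b]" using snoc.prems(5) by (cases q rule: rev_cases) auto
      have ab: "a = v" "b = v" using snoc.prems q by (auto simp: path_between_def)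
      show ?case
      proof (cases "p = []")
        case True
        then show ?thesis using snoc.prems q ab by auto
      next
        case False
        then have q': "q' \<noteq> []" using snoc.prems(3,5) q by auto
        have 1: "path_between X u (last p) p" "(last p, v) \<in> parcs X"
          using snoc.prems(2) path_between_snoc[OF wf False] ab by auto
        have 2: "path_between X u (last q') q'" "(last q', v) \<in> parcs X"
          using snoc.prems(4) path_between_snoc[OF wf q'] ab q by auto
        have len: "length p = gdist X u v" "length q' = gdist X u v" using snoc.prems q by auto
        have *: "gdist X u v = gdist X u (last s) + 1"
          if s: "path_between X u (last s) s" "(last s, v) \<in> parcs X" "length s = gdist X u v" "s \<noteq> []" for s
        proof -
          have "gdist X u (last s) \<le> length s - 1"
            using gdist_le[OF path_between_imp_relpow[OF wf s(1)]] .
          moreover have "length s > 0" using s(4) by simp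
          ultimately show ?thesis
            using gdist_step[OF snoc.prems(1) s(2)] s(3) by linarith
        qed
        note d = *[OF 1 len(1) False] *[OF 2 len(2) q']
        have l: "last p = last q'"
          using unique_predecessorsD[OF up snoc.prems(1) 1(2) 2(2) d] .
        have "p = q'"
          using snoc.IH[of "last p" q'] snoc.prems(1) 1 2 l d len by simp
        then show ?thesis using q ab by simp
      qed
    qed simp
    show "geodetic X"
      unfolding geodetic_def
    proof (intro conjI ballI)
      fix u v assume uv: "u \<in> pverts X" "v \<in> pverts X"
      show "\<exists>!p. shortest_path X u v p"
        using path[OF uv] eq[OF uv(1)] unfolding shortest_path_iff[OF uv] by blast
    qed (rule connected_with_proj)
  }
qed

end

section \<open>Subdividing edges into an odd number of parts\<close>

text \<open>
  An odd number that divides \<open>2 * x\<close> divides \<open>x\<close>, which is too small for that unless it vanishes.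
\<close>

lemma two_mult_eq_odd_mult:
  fixes m x t :: int
  assumes "odd m" "2 * x = m * t" "\<bar>x\<bar> < m"
  shows "x = 0 \<and> t = 0"
proof -
  have "coprime m 2" using assms(1) by simp
  moreover have "m dvd 2 * x" using assms(2) by simp
  ultimately have "m dvd x" by (simp add: coprime_dvd_mult_right_iff)
  then have "x = 0" using assms(3) dvd_imp_le_int[of x m] by linarith
  then show ?thesis using assms by auto
qed

text \<open>
  The arithmetic of ties.  Let \<open>x\<close> be at distance \<open>k\<close> from \<open>u\<close> on the subdivided edge \<open>uv\<close>, let
  \<open>y\<close> be at distance \<open>l\<close> from \<open>w\<close> on \<open>wz\<close>, and let \<open>a, b, c, d\<close> be the distances of
  \<open>(u, w), (v, w), (u, z), (v, z)\<close> in the original graph.  The equation says that \<open>x\<close> is as far from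
  \<open>y\<close> through \<open>w\<close> as it is through \<open>z\<close>.  Both routes cannot leave through the same end of \<open>uv\<close>,
  since \<open>m\<close> would divide \<open>2 * l\<close>; and if they leave through different ends, then divisibility of
  \<open>2 * (k + l)\<close> or \<open>2 * (l - k)\<close> by \<open>m\<close> leaves only \<open>k + l = m\<close> or \<open>k = l\<close>.
\<close>

lemma odd_min_tie:
  fixes m k l a b c d :: nat
  assumes m: "odd m" and k: "0 < k" "k < m" and l: "0 < l" "l < m"
    and eq: "min (k + m * a) (m - k + m * b) + l = min (k + m * c) (m - k + m * d) + (m - l)"
  shows "(a = d \<and> a \<le> b \<and> a \<le> c \<and> \<not> (b = a \<and> c = a)) \<or>
         (b = c \<and> b \<le> a \<and> b \<le> d \<and> \<not> (a = b \<and> d = b))"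
proof -
  define M K N A B C D where ints: "M = int m" "K = int k" "N = int l"
      "A = int a" "B = int b" "C = int c" "D = int d"
  note pos = k l m
  have M: "odd M" "0 < K" "K < M" "0 < N" "N < M" using pos by (auto simp: ints)
  have nn: "A \<ge> 0" "B \<ge> 0" "C \<ge> 0" "D \<ge> 0" by (auto simp: ints)
  have E: "min (K + M * A) (M - K + M * B) + N = min (K + M * C) (M - K + M * D) + (M - N)"
  proof -
    have "int (m - k) = M - K" "int (m - l) = M - N" using pos by (simp_all add: ints of_nat_diff)
    then show ?thesis
      using arg_cong[OF eq, of int] by (simp only: of_nat_min of_nat_add of_nat_mult ints)
  qed
  have le: "x \<le> y" if "M * x < M * (y + 1)" for x y
    using that M by (simp add: mult_less_cancel_left_pos)
  consider
      (uu) "K + M * A + N = K + M * C + (M - N)"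
    | (vv) "M - K + M * B + N = M - K + M * D + (M - N)"
    | (uv) "K + M * A + N = M - K + M * D + (M - N)" "K + M * A \<le> M - K + M * B" "M - K + M * D \<le> K + M * C"
    | (vu) "M - K + M * B + N = K + M * C + (M - N)" "M - K + M * B \<le> K + M * A" "K + M * C \<le> M - K + M * D"
    using E by (smt (verit))
  then show ?thesis
  proof cases
    case uu
    then have "2 * N = M * (C + 1 - A)" by (simp add: algebra_simps)
    then show ?thesis using two_mult_eq_odd_mult[OF M(1), of N] M by force
  next
    case vv
    then have "2 * N = M * (D + 1 - B)" by (simp add: algebra_simps)
    then show ?thesis using two_mult_eq_odd_mult[OF M(1), of N] M by force
  next
    case uv
    then have "2 * (K + N - M) = M * (D - A)" by (simp add: algebra_simps)
    then have *: "K + N = M" "D = A" using two_mult_eq_odd_mult[OF M(1), of "K + N - M"] M by force+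
    have "A \<le> B" using uv(2) M by (intro le) (simp add: algebra_simps)
    moreover have "A \<le> C" using uv(3) M * by (intro le) (simp add: algebra_simps)
    \<comment> \<open>If all three distances agreed, \<open>x\<close> would be the midpoint of an edge with an odd number of parts.\<close>
    moreover have "\<not> (B = A \<and> C = A)"
    proof
      assume "B = A \<and> C = A"
      then have "2 * K = M" using uv(2,3) * by simp
      then show False using M(1) by auto
    qed
    ultimately show ?thesis using * by (simp add: ints)
  next
    case vu
    then have "2 * (N - K) = M * (C - B)" by (simp add: algebra_simps)
    then have *: "N = K" "C = B" using two_mult_eq_odd_mult[OF M(1), of "N - K"] M by force+
    have "B \<le> A" using vu(2) M by (intro le) (simp add: algebra_simps)
    moreover have "B \<le> D" using vu(3) M * by (intro le) (simp add: algebra_simps)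
    moreover have "\<not> (A = B \<and> D = B)"
    proof
      assume "A = B \<and> D = B"
      then have "2 * K = M" using vu(2,3) * by simp
      then show False using M(1) by auto
    qed
    ultimately show ?thesis using * by (simp add: ints)
  qed
qed

text \<open>
  The quantities have the same meaning as before, with \<open>a', b'\<close> taken at a neighbour of the vertex of
  \<open>a, b\<close>.  The residues of \<open>k\<close> and \<open>m - k\<close> modulo \<open>m\<close> differ, so the minimum reveals through which
  end of its edge \<open>x\<close> is left, and this end is the same on both sides.
\<close>

lemma odd_min_step:
  fixes m k a b a' b' :: nat
  assumes m: "odd m" and k: "0 < k" "k < m"
    and eq: "min (k + m * a) (m - k + m * b) = min (k + m * a') (m - k + m * b') + m"
  shows "if k + m * a \<le> m - k + m * b then a = a' + 1 else b = b' + 1"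
proof -
  define M K A B A' B' where ints: "M = int m" "K = int k"
      "A = int a" "B = int b" "A' = int a'" "B' = int b'"
  note pos = k m
  have M: "odd M" "0 < K" "K < M" using pos by (auto simp: ints)
  have E: "min (K + M * A) (M - K + M * B) = min (K + M * A') (M - K + M * B') + M"
  proof -
    have "int (m - k) = M - K" using pos by (simp add: ints of_nat_diff)
    then show ?thesis
      using arg_cong[OF eq, of int] by (simp only: of_nat_min of_nat_add of_nat_mult ints)
  qed
  have L: "k + m * a \<le> m - k + m * b \<longleftrightarrow> K + M * A \<le> M - K + M * B"
  proof -
    have ik: "int (m - k) = M - K" using pos by (simp add: ints of_nat_diff)
    have "int (k + m * a) = K + M * A" "int (m - k + m * b) = M - K + M * B"
      by (simp_all only: of_nat_add of_nat_mult ints(3,4) ik) (simp_all add: ints)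
    then show ?thesis by linarith
  qed
  have cancel: "x = y + 1" if "M * x = M * y + M" for x y
  proof -
    have "M * x = M * (y + 1)" using that by (simp add: algebra_simps)
    then show ?thesis using M by simp
  qed
  consider
      (uu) "K + M * A \<le> M - K + M * B" "K + M * A = K + M * A' + M"
    | (vv) "\<not> K + M * A \<le> M - K + M * B" "M - K + M * B = M - K + M * B' + M"
    | (uv) "K + M * A = M - K + M * B' + M"
    | (vu) "M - K + M * B = K + M * A' + M"
    using E by (smt (verit))
  then show ?thesis
  proof cases
    case uu
    then show ?thesis using cancel[of A A'] L by (simp add: ints)
  next
    case vv
    then show ?thesis using cancel[of B B'] L by (simp add: ints)
  next
    case uv
    then have "2 * K = M * (B' + 2 - A)" by (simp add: algebra_simps)
    then show ?thesis using two_mult_eq_odd_mult[OF M(1), of K] M by force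
  next
    case vu
    then have "2 * K = M * (B - A')" by (simp add: algebra_simps)
    then show ?thesis using two_mult_eq_odd_mult[OF M(1), of K] M by force
  qed
qed

context connected_graph
begin

lemma gdist_step_left:
  assumes "w \<in> pverts X" "(u, v) \<in> parcs X"
  shows "gdist X u w \<le> gdist X v w + 1"
  using gdist_step[OF assms(1) arc_sym[OF assms(2)]] by (simp add: gdist_commute)

text \<open>
  A shortest path from \<open>u\<close> to \<open>z\<close> may start with the edge \<open>uv\<close>, and one may end with the edge \<open>wz\<close>.
  If \<open>v\<close> and \<open>z\<close> differ, then the first one reaches \<open>z\<close> from some \<open>z'\<close> that is closer to \<open>v\<close>
  than \<open>z\<close>, and uniqueness of the predecessor of \<open>z\<close> makes \<open>z'\<close> equal to \<open>w\<close>; but \<open>w\<close> is not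
  closer to \<open>v\<close>.
\<close>

lemma opposite_edge_eq_aux:
  assumes up: "unique_predecessors X" and arcs: "(u, v) \<in> parcs X" "(w, z) \<in> parcs X"
    and eq: "gdist X u w = gdist X v z"
    and far: "gdist X u z = gdist X u w + 1" and ge: "gdist X u w \<le> gdist X v w"
  shows "u = w \<and> v = z"
proof -
  note V = in_arcsD1[OF arcs(1)] in_arcsD2[OF arcs(1)] in_arcsD1[OF arcs(2)] in_arcsD2[OF arcs(2)]
  show ?thesis
  proof (cases "v = z")
    case True
    then show ?thesis using eq gdist_eq_0[OF V(1,3)] by simp
  next
    case False
    then obtain z' where z': "(z', z) \<in> parcs X" "gdist X v z = gdist X v z' + 1"
      using gdist_pred[OF V(2,4)] by metis
    have "gdist X u z' \<le> gdist X v z' + 1"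
      using gdist_step_left[OF in_arcsD1[OF z'(1)] arcs(1)] .
    moreover have "gdist X u z \<le> gdist X u z' + 1" using gdist_step[OF V(1) z'(1)] .
    ultimately have "gdist X u z = gdist X u z' + 1" using z'(2) eq far by linarith
    then have "z' = w" using unique_predecessorsD[OF up V(1) z'(1) arcs(2)] far by blast
    then show ?thesis using z'(2) ge eq by simp
  qed
qed

text \<open>
  The distances of a tie are possible only when the two edges coincide.
\<close>

lemma opposite_edge_eq:
  assumes up: "unique_predecessors X" and arcs: "(u, v) \<in> parcs X" "(w, z) \<in> parcs X"
    and eq: "gdist X u w = gdist X v z"
    and ge: "gdist X u w \<le> gdist X v w" "gdist X u w \<le> gdist X u z"
    and neq: "\<not> (gdist X v w = gdist X u w \<and> gdist X u z = gdist X u w)"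
  shows "u = w \<and> v = z"
proof (cases "gdist X u z = gdist X u w")
  case False
  then have "gdist X u z = gdist X u w + 1"
    using gdist_step[OF in_arcsD1[OF arcs(1)] arcs(2)] ge by linarith
  then show ?thesis using opposite_edge_eq_aux[OF up arcs eq] ge by blast
next
  case True
  then have "gdist X v w = gdist X v z + 1"
    using gdist_step_left[OF in_arcsD1[OF arcs(2)] arc_sym[OF arcs(1)]] ge neq eq by linarith
  then show ?thesis
    using opposite_edge_eq_aux[OF up arc_sym[OF arcs(1)] arc_sym[OF arcs(2)]] eq ge by simp
qed

end

locale odd_subdivision = connected_graph X for X :: "'a pair_pre_digraph" +
  fixes m :: nat
  assumes odd_m: "odd m"
begin

abbreviation "Y \<equiv> subdivided_graph m X"
abbreviation "pt \<equiv> sd_point m"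

lemma m_pos: "0 < m"
  using odd_m by (rule odd_pos)

sublocale Y: pair_bidirected_digraph Y
  by (rule pair_bidirected_subdivided_graph) unfold_locales

lemma pt_0 [simp]: "pt g h 0 = Orig g" and pt_m [simp]: "pt g h m = Orig h"
  using m_pos by (auto simp: sd_point_def)

lemma pt_neq_Orig [simp]: "\<lbrakk>0 < k; k < m\<rbrakk> \<Longrightarrow> pt g h k \<noteq> Orig v"
  by (auto simp: sd_point_def)

lemma Orig_neq_pt [simp]: "\<lbrakk>0 < k; k < m\<rbrakk> \<Longrightarrow> Orig v \<noteq> pt g h k"
  using pt_neq_Orig by metis

lemma Orig_vert [simp]: "Orig v \<in> pverts Y \<longleftrightarrow> v \<in> pverts X"
  using in_arcsD1 in_arcsD2 by (auto simp: subdivided_graph_def sd_point_def split: if_splits)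

lemma pt_vert: "\<lbrakk>(g, h) \<in> parcs X; k \<le> m\<rbrakk> \<Longrightarrow> pt g h k \<in> pverts Y"
  by (auto simp: subdivided_graph_def)

lemma vert_cases [consumes 1, case_names Orig interior]:
  assumes "x \<in> pverts Y"
  obtains u where "u \<in> pverts X" "x = Orig u"
    | u v k where "(u, v) \<in> parcs X" "0 < k" "k < m" "x = pt u v k"
proof -
  consider u where "u \<in> pverts X" "x = Orig u" | u v k where "(u, v) \<in> parcs X" "k \<le> m" "x = pt u v k"
    using assms by (auto simp: subdivided_graph_def)
  then show thesis
  proof cases
    case (2 u v k)
    then show thesis
      using that(1)[of u] that(1)[of v] that(2)[of u v k] in_arcsD1 in_arcsD2 m_pos
      by (cases "k = 0"; cases "k = m") auto
  qed (use that in blast)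
qed

lemma pt_arc: "\<lbrakk>(g, h) \<in> parcs X; k < m\<rbrakk> \<Longrightarrow> (pt g h k, pt g h (Suc k)) \<in> parcs Y"
  by (auto simp: subdivided_graph_def)

lemma Y_arc_sym: "(x, y) \<in> parcs Y \<Longrightarrow> (y, x) \<in> parcs Y"
  using Y.pair_sym_arcs by (auto simp: symmetric_def sym_def)

text \<open>
  Inside an edge the subdivided graph is a path, whatever description of the edge the arc comes with.
\<close>

lemma arc_into_interior:
  assumes "(y, pt w z l) \<in> parcs Y" "(w, z) \<in> parcs X" "0 < l" "l < m"
  shows "y = pt w z (l - 1) \<or> y = pt w z (l + 1)"
proof -
  obtain g h k where e: "(g, h) \<in> parcs X" "k < m" "y = pt g h k" "pt w z l = pt g h (Suc k)"
    using assms(1) by (auto simp: subdivided_graph_def)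
  have "w = g \<and> z = h \<and> l = Suc k \<or> w = h \<and> z = g \<and> l + Suc k = m"
    using sd_point_eqD[OF arc_neq[OF assms(2)] _ _ e(4)] e(2) assms(3,4) by auto
  then show ?thesis
  proof
    assume "w = h \<and> z = g \<and> l + Suc k = m"
    then have "y = pt z w k" "k = m - (l + 1)" using e by auto
    then have "y = pt w z (l + 1)" using sd_point_flip[of "l + 1" m z w] assms(3,4) by simp
    then show ?thesis ..
  qed (use e in auto)
qed

lemma arc_into_Orig:
  assumes "(y, Orig w) \<in> parcs Y"
  obtains z where "(w, z) \<in> parcs X" "y = pt w z 1"
proof -
  obtain g h k where e: "(g, h) \<in> parcs X" "k < m" "y = pt g h k" "Orig w = pt g h (Suc k)"
    using assms by (auto simp: subdivided_graph_def)
  have "Suc k = m" "h = w" using e(2,4) by (auto simp: sd_point_def split: if_splits)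
  then have "y = pt w g 1" using e(3) sd_point_flip[of 1 m g w] m_pos by auto
  then show thesis using that arc_sym e(1) \<open>h = w\<close> by blast
qed

lemma reach_along_edge:
  assumes "(g, h) \<in> parcs X"
  shows "k \<le> m \<Longrightarrow> (Orig g, pt g h k) \<in> (parcs Y)\<^sup>*"
proof (induction k)
  case (Suc k)
  then show ?case using pt_arc[OF assms, of k] by (meson Suc_leD Suc_le_lessD rtrancl.rtrancl_into_rtrancl)
qed simp

sublocale Y: connected_graph Y
proof
  show "pverts Y \<noteq> {}" using nonempty by (auto simp: subdivided_graph_def)
next
  have sym: "(y, x) \<in> (parcs Y)\<^sup>*" if "(x, y) \<in> (parcs Y)\<^sup>*" for x y
    using that Y_arc_sym by (meson symD symI sym_rtrancl)
  have Orig: "(Orig u, Orig v) \<in> (parcs Y)\<^sup>*" if "(u, v) \<in> (parcs X)\<^sup>*" for u v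
    using that
  proof induction
    case (step v w)
    then show ?case using reach_along_edge[OF step(2), of m] by simp
  qed simp
  have near: "\<exists>u\<in>pverts X. (Orig u, x) \<in> (parcs Y)\<^sup>*" if "x \<in> pverts Y" for x
    using that
  proof (cases rule: vert_cases)
    case (interior u v k)
    then show ?thesis using reach_along_edge[of u v k] in_arcsD1 by auto
  qed auto
  fix x y assume "x \<in> pverts Y" "y \<in> pverts Y"
  then obtain u v where "u \<in> pverts X" "v \<in> pverts X"
      "(Orig u, x) \<in> (parcs Y)\<^sup>*" "(Orig v, y) \<in> (parcs Y)\<^sup>*"
    using near by meson
  then show "(x, y) \<in> (parcs Y)\<^sup>*"
    using sym Orig reach by (meson rtrancl_trans)
qed

abbreviation "D \<equiv> gdist X"
abbreviation "E \<equiv> gdist Y"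

lemma E_le_along_edge:
  assumes "x \<in> pverts Y" "(w, z) \<in> parcs X"
  shows "l \<le> m \<Longrightarrow> E x (pt w z l) \<le> E x (Orig w) + l"
proof (induction l)
  case (Suc l)
  then show ?case using Y.gdist_step[OF assms(1) pt_arc[OF assms(2), of l]] by simp
qed simp

lemma E_le_along_edge':
  assumes "x \<in> pverts Y" "(w, z) \<in> parcs X" "l \<le> m"
  shows "E x (pt w z l) \<le> E x (Orig z) + (m - l)"
  using E_le_along_edge[OF assms(1) arc_sym[OF assms(2)], of "m - l"] sd_point_flip[of l m z w]
    assms(3) m_pos by simp

text \<open>
  An interior point of an edge can only be entered from its two neighbours on that edge, so a shortest
  path from outside the edge runs along it from one of its ends.
\<close>

lemma E_interior:
  assumes x: "x \<in> pverts Y" and wz: "(w, z) \<in> parcs X"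
    and out: "\<And>k. \<lbrakk>0 < k; k < m\<rbrakk> \<Longrightarrow> x \<noteq> pt w z k"
    and l: "l \<le> m"
  shows "E x (pt w z l) = min (E x (Orig w) + l) (E x (Orig z) + (m - l))"
proof (rule antisym)
  show "E x (pt w z l) \<le> min (E x (Orig w) + l) (E x (Orig z) + (m - l))"
    using E_le_along_edge[OF x wz l] E_le_along_edge'[OF x wz l] by simp
  show "min (E x (Orig w) + l) (E x (Orig z) + (m - l)) \<le> E x (pt w z l)"
    using l
  proof (induction "E x (pt w z l)" arbitrary: l rule: less_induct)
    case less
    show ?case
    proof (cases "l = 0 \<or> l = m")
      case False
      then have l: "0 < l" "l < m" using less.prems by auto
      have "pt w z l \<noteq> x" using out[OF l] by blast
      then obtain y where y: "(y, pt w z l) \<in> parcs Y" "E x (pt w z l) = E x y + 1"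
        using Y.gdist_pred[OF x pt_vert[OF wz less.prems]] by metis
      consider "y = pt w z (l - 1)" | "y = pt w z (l + 1)"
        using arc_into_interior[OF y(1) wz l] by blast
      then show ?thesis
      proof cases
        case 1
        then have "min (E x (Orig w) + (l - 1)) (E x (Orig z) + (m - (l - 1))) \<le> E x y"
          using less.hyps[of "l - 1"] y(2) l by simp
        then show ?thesis using y(2) l by linarith
      next
        case 2
        then have "min (E x (Orig w) + (l + 1)) (E x (Orig z) + (m - (l + 1))) \<le> E x y"
          using less.hyps[of "l + 1"] y(2) l by simp
        then show ?thesis using y(2) l by linarith
      qed
    qed auto
  qed
qed

lemma E_pred_of_Orig:
  assumes x: "x \<in> pverts Y" and wz: "(w, z) \<in> parcs X"
    and out: "\<And>k. \<lbrakk>0 < k; k < m\<rbrakk> \<Longrightarrow> x \<noteq> pt w z k"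
    and pred: "E x (Orig w) = E x (pt w z 1) + 1"
  shows "E x (Orig w) = E x (Orig z) + m"
  using E_interior[OF x wz out, of 1] pred m_pos by (auto simp: min_def split: if_splits)

lemma E_Orig_Orig:
  assumes "u \<in> pverts X" "w \<in> pverts X"
  shows "E (Orig u) (Orig w) = m * D u w"
proof (rule antisym)
  have u: "Orig u \<in> pverts Y" using assms by simp
  show "E (Orig u) (Orig w) \<le> m * D u w"
    using assms(2)
  proof (induction "D u w" arbitrary: w)
    case 0
    then show ?case using gdist_eq_0[OF assms(1)] by force
  next
    case (Suc d)
    then have "w \<noteq> u" by auto
    then obtain z where z: "(z, w) \<in> parcs X" "D u w = D u z + 1"
      using gdist_pred[OF assms(1)] Suc.prems by metis
    have "E (Orig u) (Orig w) \<le> E (Orig u) (Orig z) + m"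
      using E_le_along_edge[OF u z(1), of m] by simp
    also have "\<dots> \<le> m * D u z + m"
      using Suc.hyps(1)[of z] Suc.hyps(2) z in_arcsD1 by simp
    finally show ?case using z(2) by (simp add: algebra_simps)
  qed
  show "m * D u w \<le> E (Orig u) (Orig w)"
    using assms(2)
  proof (induction "E (Orig u) (Orig w)" arbitrary: w rule: less_induct)
    case less
    show ?case
    proof (cases "w = u")
      case False
      then obtain y where y: "(y, Orig w) \<in> parcs Y" "E (Orig u) (Orig w) = E (Orig u) y + 1"
        using Y.gdist_pred[OF u, of "Orig w"] less.prems by auto
      obtain z where z: "(w, z) \<in> parcs X" "y = pt w z 1" using arc_into_Orig[OF y(1)] .
      have eq: "E (Orig u) (Orig w) = E (Orig u) (Orig z) + m"
        using E_pred_of_Orig[OF u z(1)] pt_neq_Orig y(2) z(2) by metis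
      then have "m * D u z \<le> E (Orig u) (Orig z)"
        using less.hyps[of z] m_pos in_arcsD2[OF z(1)] by simp
      moreover have "D u w \<le> D u z + 1" using gdist_step[OF assms(1) arc_sym[OF z(1)]] .
      then have "m * D u w \<le> m * D u z + m"
        by (metis mult_le_mono2 mult.right_neutral add_mult_distrib2)
      ultimately show ?thesis using eq by simp
    qed simp
  qed
qed

text \<open>
  Original vertices are not interior to any edge, so \<open>E_interior\<close> applies with the roles of root and
  target exchanged.
\<close>

lemma E_interior_Orig:
  assumes uv: "(u, v) \<in> parcs X" and k: "0 < k" "k < m" and w: "w \<in> pverts X"
  shows "E (pt u v k) (Orig w) = min (k + m * D u w) (m - k + m * D v w)"
proof -
  have "E (Orig w) (pt u v k) = min (E (Orig w) (Orig u) + k) (E (Orig w) (Orig v) + (m - k))"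
    by (rule E_interior) (use w uv k in auto)
  then show ?thesis
    using E_Orig_Orig w in_arcsD1[OF uv] in_arcsD2[OF uv]
    by (simp add: Y.gdist_commute[of _ "Orig w"] gdist_commute[of _ w] add.commute)
qed

text \<open>
  Leaving the edge and coming back is never shorter, as the two ends of the edge are \<open>m\<close> apart.
\<close>

lemma E_same_edge:
  assumes uv: "(u, v) \<in> parcs X" and k: "0 < k" "k < m" and l: "l \<le> m"
  shows "E (pt u v k) (pt u v l) = (if l \<le> k then k - l else l - k)"
proof (rule antisym)
  have x: "pt u v k \<in> pverts Y" using pt_vert uv k by simp
  have ends: "E (pt u v k) (Orig u) = k" "E (pt u v k) (Orig v) = m - k"
  proof -
    have "D u v = 1" "D v u = 1"
      using gdist_step[OF in_arcsD1[OF uv] uv] gdist_eq_0[OF in_arcsD1[OF uv] in_arcsD2[OF uv]]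
        arc_neq[OF uv] gdist_commute[of u v] by force+
    then show "E (pt u v k) (Orig u) = k" "E (pt u v k) (Orig v) = m - k"
      using E_interior_Orig[OF uv k] in_arcsD1[OF uv] in_arcsD2[OF uv] k by auto
  qed
  have up: "E (pt u v k) (pt u v (k + j)) \<le> j" if "k + j \<le> m" for j
    using that
  proof (induction j)
    case (Suc j)
    then show ?case using Y.gdist_step[OF x pt_arc[OF uv, of "k + j"]] by simp
  qed simp
  have down: "E (pt u v k) (pt u v (k - j)) \<le> j" if "j \<le> k" for j
    using that
  proof (induction j)
    case (Suc j)
    then have "(pt u v (k - j), pt u v (k - Suc j)) \<in> parcs Y"
      using Y_arc_sym[OF pt_arc[OF uv, of "k - Suc j"]] k by (simp add: Suc_diff_Suc)
    then show ?case using Y.gdist_step[OF x, of "pt u v (k - j)" "pt u v (k - Suc j)"] Suc by simp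
  qed simp
  show "E (pt u v k) (pt u v l) \<le> (if l \<le> k then k - l else l - k)"
    using up[of "l - k"] down[of "k - l"] l by auto
  show "(if l \<le> k then k - l else l - k) \<le> E (pt u v k) (pt u v l)"
    using l
  proof (induction "E (pt u v k) (pt u v l)" arbitrary: l rule: less_induct)
    case less
    consider "l = 0" | "l = m" | "l = k" | "0 < l" "l < m" "l \<noteq> k" using less.prems by linarith
    then show ?case
    proof cases
      case 4
      have "pt u v l \<noteq> pt u v k"
        using sd_point_eqD[OF arc_neq[OF uv], of l m k u v] 4 k arc_neq[OF uv] by auto
      then obtain y where y: "(y, pt u v l) \<in> parcs Y" "E (pt u v k) (pt u v l) = E (pt u v k) y + 1"
        using Y.gdist_pred[OF x pt_vert[OF uv less.prems]] by metis
      consider "y = pt u v (l - 1)" | "y = pt u v (l + 1)"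
        using arc_into_interior[OF y(1) uv 4(1,2)] by blast
      then show ?thesis
      proof cases
        case 1
        then have "(if l - 1 \<le> k then k - (l - 1) else (l - 1) - k) \<le> E (pt u v k) y"
          using less.hyps[of "l - 1"] y(2) 4 by simp
        then show ?thesis using y(2) 4 by (auto split: if_splits)
      next
        case 2
        then have "(if l + 1 \<le> k then k - (l + 1) else (l + 1) - k) \<le> E (pt u v k) y"
          using less.hyps[of "l + 1"] y(2) 4 by simp
        then show ?thesis using y(2) 4 by (auto split: if_splits)
      qed
    qed (use ends k in auto)
  qed
qed

lemma no_tie:
  assumes up: "unique_predecessors X" and x: "x \<in> pverts Y" and wz: "(w, z) \<in> parcs X"
    and out: "\<And>k. \<lbrakk>0 < k; k < m\<rbrakk> \<Longrightarrow> x \<noteq> pt w z k" and l: "0 < l" "l < m"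
  shows "E x (Orig w) + l \<noteq> E x (Orig z) + (m - l)"
proof
  assume tie: "E x (Orig w) + l = E x (Orig z) + (m - l)"
  note V = in_arcsD1[OF wz] in_arcsD2[OF wz]
  from x show False
  proof (cases rule: vert_cases)
    case (Orig u)
    then have "m * D u w + l = m * D u z + (m - l)" using tie E_Orig_Orig V by simp
    then have "int m * int (D u w) + int l = int m * int (D u z) + (int m - int l)"
      using l by (metis less_imp_le_nat of_nat_add of_nat_diff of_nat_mult)
    then have "2 * int l = int m * (int (D u z) + 1 - int (D u w))" by (simp add: algebra_simps)
    then show False using two_mult_eq_odd_mult[of "int m" "int l"] odd_m l by force
  next
    case (interior u v k)
    have "(D u w = D v z \<and> D u w \<le> D v w \<and> D u w \<le> D u z \<and> \<not> (D v w = D u w \<and> D u z = D u w)) \<or>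
        (D v w = D u z \<and> D v w \<le> D u w \<and> D v w \<le> D v z \<and> \<not> (D u w = D v w \<and> D v z = D v w))"
      using tie E_interior_Orig[OF interior(1-3)] V interior(4)
      by (intro odd_min_tie[OF odd_m interior(2,3) l]) simp
    then have "u = w \<and> v = z \<or> v = w \<and> u = z"
      using opposite_edge_eq[OF up interior(1) wz]
        opposite_edge_eq[OF up arc_sym[OF interior(1)] wz] by blast
    then show False
      using out[of k] out[of "m - k"] interior sd_point_flip[of k m w z] m_pos by auto
  qed
qed

text \<open>
  Both neighbours of an interior point precede it only if the ways through the two ends of its edge
  are equally long.
\<close>

lemma unique_predecessors_interior:
  assumes up: "unique_predecessors X" and x: "x \<in> pverts Y" and wz: "(w, z) \<in> parcs X"
    and l: "0 < l" "l < m"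
  shows "\<not> (E x (pt w z l) = E x (pt w z (l - 1)) + 1 \<and> E x (pt w z l) = E x (pt w z (l + 1)) + 1)"
proof (cases "\<exists>k. 0 < k \<and> k < m \<and> x = pt w z k")
  case True
  then obtain k where "0 < k" "k < m" "x = pt w z k" by blast
  then show ?thesis using E_same_edge[OF wz, of k] l by auto
next
  case False
  then have out: "\<And>k. \<lbrakk>0 < k; k < m\<rbrakk> \<Longrightarrow> x \<noteq> pt w z k" by blast
  show ?thesis
    using E_interior[OF x wz out, of l] E_interior[OF x wz out, of "l - 1"]
      E_interior[OF x wz out, of "l + 1"] no_tie[OF up x wz out l] l by (auto simp: min_def split: if_splits)
qed

text \<open>
  The end \<open>u\<close> of the edge containing the root is at distance \<open>k < m\<close>, too near to be reached along
  any other edge.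
\<close>

lemma pred_of_own_end:
  assumes uv: "(u, v) \<in> parcs X" and k: "0 < k" "k < m" and uz: "(u, z) \<in> parcs X"
    and pred: "E (pt u v k) (Orig u) = E (pt u v k) (pt u z 1) + 1"
  shows "z = v"
proof (rule ccontr)
  assume "z \<noteq> v"
  then have out: "pt u v k \<noteq> pt u z j" if "0 < j" "j < m" for j
    using sd_point_eqD[OF arc_neq[OF uv], of k m j u z] that k arc_neq[OF uv] by auto
  have "E (pt u v k) (Orig u) = E (pt u v k) (Orig z) + m"
    by (rule E_pred_of_Orig[OF _ uz out pred]) (use pt_vert uv k in auto)
  moreover have "E (pt u v k) (Orig u) = k" using E_same_edge[OF uv k, of 0] by simp
  ultimately show False using k by simp
qed

text \<open>
  Unless \<open>w\<close> is an end of the edge containing the root \<open>x\<close>, its predecessors lie on the edges that lead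
  to its predecessors in the original graph, seen from \<open>x\<close> itself if it is an original vertex and
  otherwise from the end through which shortest paths from \<open>x\<close> to \<open>w\<close> leave the edge of \<open>x\<close>.
\<close>

lemma unique_predecessors_Orig:
  assumes up: "unique_predecessors X" and x: "x \<in> pverts Y"
    and wz: "(w, z) \<in> parcs X" "E x (Orig w) = E x (pt w z 1) + 1"
    and wz': "(w, z') \<in> parcs X" "E x (Orig w) = E x (pt w z' 1) + 1"
  shows "z = z'"
  using x
proof (cases rule: vert_cases)
  note V = in_arcsD1[OF wz(1)] in_arcsD2[OF wz(1)] in_arcsD2[OF wz'(1)]
  case (Orig u)
  have "D u w = D u y + 1" if y: "(w, y) \<in> parcs X" "E x (Orig w) = E x (pt w y 1) + 1" for y
  proof -
    have "E x (Orig w) = E x (Orig y) + m"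
      using E_pred_of_Orig[OF x y(1)] y(2) pt_neq_Orig Orig by metis
    then have "m * D u w = m * (D u y + 1)"
      using Orig E_Orig_Orig V in_arcsD2[OF y(1)] by (simp add: algebra_simps)
    then show ?thesis using m_pos by (metis mult_cancel1 not_gr0)
  qed
  then show ?thesis
    using unique_predecessorsD[OF up Orig(1) arc_sym[OF wz(1)] arc_sym[OF wz'(1)]] wz wz' by blast
next
  case (interior u v k)
  note V = in_arcsD1[OF wz(1)] in_arcsD2[OF wz(1)] in_arcsD2[OF wz'(1)]
  have flip: "x = pt v u (m - k)" using interior sd_point_flip[of k m v u] m_pos by simp
  consider "w = u" | "w = v" | "w \<noteq> u" "w \<noteq> v" by blast
  then show ?thesis
  proof cases
    case 1
    then show ?thesis
      using pred_of_own_end[OF interior(1-3)] wz wz' interior(4) by metis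
  next
    case 2
    have "0 < m - k" "m - k < m" using interior by auto
    then show ?thesis
      using pred_of_own_end[OF arc_sym[OF interior(1)]] wz wz' flip 2 by metis
  next
    case 3
    have out: "x \<noteq> pt w y j" if "0 < j" "j < m" for y j
      using sd_point_eqD[OF arc_neq[OF interior(1)], of k m j w y] that interior 3 by auto
    have step: "if k + m * D u w \<le> m - k + m * D v w then D u w = D u y + 1 else D v w = D v y + 1"
      if y: "(w, y) \<in> parcs X" "E x (Orig w) = E x (pt w y 1) + 1" for y
    proof (rule odd_min_step[OF odd_m interior(2,3)])
      show "min (k + m * D u w) (m - k + m * D v w) = min (k + m * D u y) (m - k + m * D v y) + m"
        using E_pred_of_Orig[OF x y(1) out y(2)] E_interior_Orig[OF interior(1-3)] interior(4)
          V in_arcsD2[OF y(1)] by simp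
    qed
    show ?thesis
      using step[OF wz] step[OF wz']
        unique_predecessorsD[OF up _ arc_sym[OF wz(1)] arc_sym[OF wz'(1)]]
        in_arcsD1[OF interior(1)] in_arcsD2[OF interior(1)] by (metis (full_types))
  qed
qed

lemma pt_1_inj:
  assumes "(w, z) \<in> parcs X" "pt w z 1 = pt w z' 1"
  shows "z = z'"
proof (cases "m = 1")
  case True
  then show ?thesis using assms by (simp add: sd_point_def)
next
  case False
  then show ?thesis
    using sd_point_eqD[OF arc_neq[OF assms(1)] _ _ assms(2)] m_pos arc_neq[OF assms(1)] by auto
qed

theorem unique_predecessors_subdivided_iff: "unique_predecessors Y \<longleftrightarrow> unique_predecessors X"
proof
  assume up: "unique_predecessors Y"
  show "unique_predecessors X"
    unfolding unique_predecessors_def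
  proof (intro ballI allI impI)
    fix u w z z'
    assume u: "u \<in> pverts X" and z: "(z, w) \<in> parcs X" "D u w = D u z + 1"
      and z': "(z', w) \<in> parcs X" "D u w = D u z' + 1"
    have step: "(pt w y 1, Orig w) \<in> parcs Y \<and> E (Orig u) (Orig w) = E (Orig u) (pt w y 1) + 1"
      if y: "(y, w) \<in> parcs X" "D u w = D u y + 1" for y
    proof -
      have wy: "(w, y) \<in> parcs X" using arc_sym y(1) .
      have "E (Orig u) (pt w y 1) = min (E (Orig u) (Orig w) + 1) (E (Orig u) (Orig y) + (m - 1))"
        by (rule E_interior) (use u wy m_pos in auto)
      moreover have "E (Orig u) (Orig w) = E (Orig u) (Orig y) + m"
        using E_Orig_Orig[OF u] in_arcsD1[OF y(1)] in_arcsD2[OF y(1)] y(2) by simp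
      moreover have "(pt w y 1, Orig w) \<in> parcs Y"
        using Y_arc_sym[OF pt_arc[OF wy, of 0]] m_pos by simp
      ultimately show ?thesis using m_pos by auto
    qed
    have "pt w z 1 = pt w z' 1"
      using unique_predecessorsD[OF up, of "Orig u" "pt w z 1" "Orig w" "pt w z' 1"]
        step[OF z] step[OF z'] u Orig_vert by blast
    then show "z = z'" using pt_1_inj[OF arc_sym[OF z(1)]] by blast
  qed
next
  assume up: "unique_predecessors X"
  show "unique_predecessors Y"
    unfolding unique_predecessors_def
  proof (intro ballI allI impI)
    fix x y p p'
    assume x: "x \<in> pverts Y" and p: "(p, y) \<in> parcs Y" "E x y = E x p + 1"
      and p': "(p', y) \<in> parcs Y" "E x y = E x p' + 1"
    have "y \<in> pverts Y" using Y.in_arcsD2[OF p(1)] .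
    then show "p = p'"
    proof (cases rule: vert_cases)
      case (Orig w)
      then show ?thesis
        using arc_into_Orig[of p w] arc_into_Orig[of p' w] p p' unique_predecessors_Orig[OF up x, of w]
        by metis
    next
      case (interior w z l)
      then show ?thesis
        using arc_into_interior[of p w z l] arc_into_interior[of p' w z l] p p'
          unique_predecessors_interior[OF up x interior(1-3)] by metis
    qed
  qed
qed

end

section \<open>Labels of walks with the same ends\<close>

text \<open>
  The rules \<open>nabla_rules\<close> for an arbitrary labelled graph: what follows depends on the subdivided Cayley
  graph only through its labelling and the action of the group on it.
\<close>

definition circuit_rules ::
    "'v pair_pre_digraph \<Rightarrow> ('v \<Rightarrow> 'v \<Rightarrow> 'x) \<Rightarrow> 'x rel \<Rightarrow> ('x list \<times> 'x list) set" where
  "circuit_rules X L r =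
        {(path_label L [u, v, u], []) | u v. (u, v) \<in> parcs X}
      \<union> {(path_label L \<alpha>, path_label L \<beta>) | \<alpha> \<beta>.
            vwalk \<alpha> (with_proj X) \<and> vwalk \<beta> (with_proj X) \<and> hd \<alpha> = hd \<beta> \<and> last \<alpha> = last \<beta> \<and>
            embedded_circuit X (vwalk_join \<alpha> (rev \<beta>)) \<and>
            odd (vwalk_length (vwalk_join \<alpha> (rev \<beta>))) \<and>
            vwalk_length \<alpha> = vwalk_length \<beta> + 1 \<and> slex X L r \<beta>}
      \<union> {(path_label L \<alpha>, path_label L \<beta>) | \<alpha> \<beta>.
            vwalk \<alpha> (with_proj X) \<and> vwalk \<beta> (with_proj X) \<and> hd \<alpha> = hd \<beta> \<and> last \<alpha> = last \<beta> \<and>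
            embedded_circuit X (vwalk_join \<alpha> (rev \<beta>)) \<and>
            4 \<le> vwalk_length (vwalk_join \<alpha> (rev \<beta>)) \<and>
            vwalk_length \<alpha> = vwalk_length \<beta> \<and> slex X L r \<beta>}"

lemma nabla_rules_eq: "nabla_rules G S S3 r n = circuit_rules (nabla_graph G S n) (nabla_label G S S3 n) r"
  by (simp add: nabla_rules_def circuit_rules_def Let_def)

lemma path_label_simps [simp]:
  "path_label L [] = []" "path_label L [u] = []"
  "path_label L (u # v # p) = L u v # path_label L (v # p)"
  by (simp_all add: path_label_def)

lemma length_path_label [simp]: "length (path_label L p) = length p - 1"
  by (induction p rule: vwalk_arcs.induct) auto

lemma path_label_split:
  "path_label L (p @ v # q) = path_label L (p @ [v]) @ path_label L (v # q)"
proof (induction p)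
  case (Cons a p)
  then show ?case by (cases p) auto
qed simp

lemma path_label_join:
  assumes "p \<noteq> []" "q \<noteq> []" "last p = hd q"
  shows "path_label L (p @ tl q) = path_label L p @ path_label L q"
proof -
  obtain p' x q' where "p = p' @ [x]" "q = x # q'"
    using assms by (cases p rule: rev_cases; cases q) auto
  then show ?thesis using path_label_split[of L p' x q'] by simp
qed

lemma vwalk_split:
  "vwalk (p @ v # q) H \<longleftrightarrow> vwalk (p @ [v]) H \<and> vwalk (v # q) H"
proof (cases "p = []")
  case True
  then show ?thesis by (auto simp: vwalk_def)
next
  case False
  then show ?thesis by (auto simp: vwalk_def vwalk_arcs_append)
qed

lemma vwalk_Cons_Cons: "vwalk (u # v # p) (with_proj X) \<longleftrightarrow>
    u \<in> pverts X \<and> (u, v) \<in> parcs X \<and> vwalk (v # p) (with_proj X)"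
  by (auto simp: vwalk_def)

lemma wf_linear_order_minus_Id:
  assumes "linear_order_on A r" "finite A"
  shows "wf (r - Id)"
proof -
  have "trans (r - Id)"
    using assms(1) by (auto simp: order_on_defs intro: trans_diff_Id)
  then have "acyclic (r - Id)" by (simp add: acyclic_irrefl irrefl_def)
  moreover have "finite (r - Id)"
    using assms by (auto simp: order_on_defs intro: finite_subset)
  ultimately show ?thesis by (simp add: finite_acyclic_wf)
qed

text \<open>
  The order is total on the alphabet only, not on the whole type.
\<close>

lemma lenlex_total_on_lists:
  assumes "linear_order_on A r" "s \<in> lists A" "t \<in> lists A" "s \<noteq> t"
  shows "(s, t) \<in> lenlex (r - Id) \<or> (t, s) \<in> lenlex (r - Id)"
proof -
  have tot: "(x, y) \<in> r - Id \<or> (y, x) \<in> r - Id" if "x \<in> A" "y \<in> A" "x \<noteq> y" for x y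
    using assms(1) that by (auto simp: order_on_defs total_on_def)
  have "(s, t) \<in> lex (r - Id) \<or> (t, s) \<in> lex (r - Id)" if "length s = length t"
    using that assms(2-)
  proof (induction s t rule: list_induct2)
    case (Cons x s y t)
    then show ?case using tot[of x y] by (cases "x = y") auto
  qed simp
  then show ?thesis by (auto simp: lenlex_conv)
qed

locale circuit_rewriting = connected_graph X for X :: "'v pair_pre_digraph" +
  fixes L :: "'v \<Rightarrow> 'v \<Rightarrow> 'x" and A :: "'x set" and r :: "'x rel"
  assumes finite_A: "finite A" and r: "linear_order_on A r"
    and L_in: "(u, v) \<in> parcs X \<Longrightarrow> L u v \<in> A"
begin

abbreviation "walk p \<equiv> vwalk p (with_proj X)"
abbreviation "lbl \<equiv> path_label L"
abbreviation "RS \<equiv> (A, circuit_rules X L r)"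

definition cong (infix \<open>\<approx>\<close> 50) where "s \<approx> t \<longleftrightarrow> equivclp (rewrite_step RS) s t"

lemma cong_refl [simp]: "s \<approx> s"
  by (simp add: cong_def)

lemma cong_sym: "s \<approx> t \<Longrightarrow> t \<approx> s"
  unfolding cong_def by (rule equivclp_sym)

lemma cong_trans [trans]: "s \<approx> t \<Longrightarrow> t \<approx> w \<Longrightarrow> s \<approx> w"
  unfolding cong_def by (rule equivclp_trans)

lemma cong_context:
  assumes "s \<approx> t" "u \<in> lists A" "v \<in> lists A"
  shows "u @ s @ v \<approx> u @ t @ v"
  using assms(1) unfolding cong_def
proof (induction rule: equivclp_induct)
  case (step y z)
  have ctx: "rewrite_step RS (u @ a @ v) (u @ b @ v)" if ab: "rewrite_step RS a b" for a b
  proof -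
    obtain u' v' l r' where e: "(l, r') \<in> circuit_rules X L r" "u' \<in> lists A" "v' \<in> lists A"
        "a = u' @ l @ v'" "b = u' @ r' @ v'"
      using ab by (auto simp: rewrite_step_def)
    have "u @ u' \<in> lists A" "v' @ v \<in> lists A"
      "u @ a @ v = (u @ u') @ l @ (v' @ v)" "u @ b @ v = (u @ u') @ r' @ (v' @ v)"
      using e assms by auto
    then show ?thesis using e(1) unfolding rewrite_step_def prod.case by (intro exI conjI)
  qed
  then have "rewrite_step RS (u @ y @ v) (u @ z @ v) \<or> rewrite_step RS (u @ z @ v) (u @ y @ v)"
    using step.hyps by blast
  then show ?case using equivclp_into_equivclp step.IH by meson
qed simp

lemma cong_append:
  assumes "s \<approx> s'" "t \<approx> t'" "s \<in> lists A" "t' \<in> lists A"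
  shows "s @ t \<approx> s' @ t'"
proof -
  have "s @ t @ [] \<approx> s @ t' @ []" by (rule cong_context) (use assms in simp_all)
  moreover have "[] @ s @ t' \<approx> [] @ s' @ t'" by (rule cong_context) (use assms in simp_all)
  ultimately show ?thesis using cong_trans by simp
qed

lemma rule_cong:
  assumes "(s, t) \<in> circuit_rules X L r"
  shows "s \<approx> t"
proof -
  have "[] \<in> lists A" "s = [] @ s @ []" "t = [] @ t @ []" by simp_all
  then have "rewrite_step RS s t"
    unfolding rewrite_step_def prod.case using assms by (intro exI conjI)
  then show ?thesis unfolding cong_def by (rule r_into_equivclp)
qed

lemma lbl_in [simp]: "walk p \<Longrightarrow> lbl p \<in> lists A"
proof (induction p)
  case (Cons a p)
  then show ?case by (cases p) (auto simp: vwalk_Cons_Cons L_in)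
qed simp

lemma walk_rev [simp]: "walk (rev p) \<longleftrightarrow> walk p"
proof -
  have "walk (rev q)" if "walk q" for q
  proof -
    have "set (vwalk_arcs (rev q)) \<subseteq> parcs X"
    proof
      fix e assume "e \<in> set (vwalk_arcs (rev q))"
      then obtain u v where "e = (v, u)" "(u, v) \<in> set (vwalk_arcs q)"
        by (auto simp: set_vwalk_arcs_rev)
      then have "(u, v) \<in> parcs X" using that by (auto simp: vwalk_def)
      then show "e \<in> parcs X" unfolding \<open>e = (v, u)\<close> by (rule arc_sym)
    qed
    then show ?thesis using that by (simp add: vwalk_def)
  qed
  from this[of p] this[of "rev p"] show ?thesis by auto
qed

lemma walk_join: "\<lbrakk>walk p; walk q; last p = hd q\<rbrakk> \<Longrightarrow> walk (p @ tl q)"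
  using vwalk_joinI_vwalk'[of p "with_proj X" q] by (simp add: vwalk_join_def)

lemma walk_not_Nil: "walk p \<Longrightarrow> p \<noteq> []"
  by (simp add: vwalk_def)

lemma lbl_back_and_forth: "(u, v) \<in> parcs X \<Longrightarrow> [L u v, L v u] \<approx> []"
proof (rule rule_cong)
  assume uv: "(u, v) \<in> parcs X"
  show "([L u v, L v u], []) \<in> circuit_rules X L r"
    unfolding circuit_rules_def
    by (rule UnI1, rule UnI1, rule CollectI, rule exI[of _ u], rule exI[of _ v]) (simp add: uv)
qed

lemma lbl_rev_cancel: "walk p \<Longrightarrow> lbl p @ lbl (rev p) \<approx> []"
proof (induction p)
  case (Cons u p)
  show ?case
  proof (cases p)
    case (Cons v q)
    then have uv: "(u, v) \<in> parcs X" "(v, u) \<in> parcs X" and w: "walk p"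
      using Cons.prems arc_sym by (auto simp: vwalk_Cons_Cons)
    have "lbl (u # p) @ lbl (rev (u # p)) = [L u v] @ (lbl p @ lbl (rev p)) @ [L v u]"
      using Cons path_label_split[of L "rev q" v "[u]"] by simp
    also have "\<dots> \<approx> [L u v] @ [] @ [L v u]"
      using Cons.IH[OF w] by (rule cong_context) (use L_in uv in auto)
    also have "\<dots> \<approx> []" using lbl_back_and_forth[OF uv(1)] by simp
    finally show ?thesis .
  qed simp
qed simp

text \<open>
  Comparing two walks with the same ends amounts to contracting the closed walk that they form, because
  a walk followed by its reverse has a label equivalent to the empty word.
\<close>

lemma lbl_cong_iff:
  assumes "walk p" "walk q" "hd p = hd q" "last p = last q"
  shows "lbl p \<approx> lbl q \<longleftrightarrow> lbl (p @ tl (rev q)) \<approx> []"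
proof -
  have q: "walk (rev q)" using assms(2) by simp
  have eq: "lbl (p @ tl (rev q)) = lbl p @ lbl (rev q)"
    using path_label_join[of p "rev q" L] assms walk_not_Nil by (simp add: hd_rev)
  note in_A = lbl_in[OF assms(1)] lbl_in[OF assms(2)] lbl_in[OF q]
  have can: "lbl q @ lbl (rev q) \<approx> []" "lbl (rev q) @ lbl q \<approx> []"
    using lbl_rev_cancel[OF assms(2)] lbl_rev_cancel[OF q] by simp_all
  show ?thesis
  proof
    assume "lbl p \<approx> lbl q"
    then show "lbl (p @ tl (rev q)) \<approx> []"
      using cong_append[OF _ cong_refl in_A(1) in_A(3)] can(1) eq cong_trans by metis
  next
    assume *: "lbl (p @ tl (rev q)) \<approx> []"
    have "lbl p @ (lbl (rev q) @ lbl q) \<approx> lbl p"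
      using cong_append[OF cong_refl can(2) in_A(1)] by simp
    moreover have "(lbl p @ lbl (rev q)) @ lbl q \<approx> lbl q"
      using cong_append[OF *[unfolded eq] cong_refl _ in_A(2)] in_A by simp
    ultimately show "lbl p \<approx> lbl q" using cong_sym cong_trans by (metis append.assoc)
  qed
qed

lemma ex_slex:
  assumes "walk p"
  obtains q where "slex X L r q" "walk q" "hd q = hd p" "last q = last p" "length q \<le> length p"
proof -
  let ?Q = "lbl ` {q. path_between X (hd p) (last p) q}"
  have "p \<in> {q. path_between X (hd p) (last p) q}" using assms by (simp add: path_between_def)
  then obtain z where "z \<in> ?Q" and zmin: "\<And>y. (y, z) \<in> lenlex (r - Id) \<Longrightarrow> y \<notin> ?Q"
    using wfE_min[OF wf_lenlex[OF wf_linear_order_minus_Id[OF r finite_A]], of _ ?Q] by blast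
  then obtain q where q: "walk q" "hd q = hd p" "last q = last p" "z = lbl q"
    by (auto simp: path_between_def)
  have least: "lbl q = lbl q' \<or> (lbl q, lbl q') \<in> lenlex (r - Id)"
    if "path_between X (hd p) (last p) q'" for q'
  proof -
    have "(lbl q', lbl q) \<notin> lenlex (r - Id)" using zmin q(4) that by blast
    moreover have "lbl q' \<in> lists A" using that by (simp add: path_between_def)
    ultimately show ?thesis
      using lenlex_total_on_lists[OF r lbl_in[OF q(1)]] by blast
  qed
  have "length (lbl q) \<le> length (lbl p)"
    using least[of p] assms by (auto simp: path_between_def lenlex_conv simp del: length_path_label)
  then have "length q \<le> length p"
    using walk_not_Nil[OF q(1)] walk_not_Nil[OF assms] by (cases q; cases p) auto
  then show thesis using that[of q] q least by (simp add: slex_def)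
qed

lemma embedded_circuit_rule:
  assumes "walk p" "walk q" "hd p = hd q" "last p = last q" "slex X L r q"
    and "embedded_circuit X (p @ tl (rev q))"
    and len: "length p = length q \<or> length p = length q + 1"
  shows "lbl p \<approx> lbl q"
proof -
  have pq: "p \<noteq> []" "q \<noteq> []" using assms(1,2) walk_not_Nil by auto
  have J: "vwalk_length (vwalk_join p (rev q)) = length p + length q - 2"
    using pq by (cases p; cases q) (auto simp: vwalk_join_def)
  have ge: "3 \<le> length p + length q - 2"
    using assms(6) J by (simp add: embedded_circuit_def vwalk_join_def)
  have emb: "embedded_circuit X (vwalk_join p (rev q))" using assms(6) by (simp add: vwalk_join_def)
  have "(lbl p, lbl q) \<in> circuit_rules X L r"
    using len
  proof
    assume l: "length p = length q"
    then have v: "4 \<le> vwalk_length (vwalk_join p (rev q))" using J ge by presburger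
    have w: "vwalk_length p = vwalk_length q" using l by simp
    show ?thesis
      unfolding circuit_rules_def
      by (rule UnI2, rule CollectI, rule exI[of _ p], rule exI[of _ q]) (intro conjI refl assms emb v w)
  next
    assume l: "length p = length q + 1"
    then have "vwalk_length (vwalk_join p (rev q)) = 2 * (length q - 1) + 1"
      using J pq by (cases q) auto
    then have v: "odd (vwalk_length (vwalk_join p (rev q)))" by presburger
    have w: "vwalk_length p = vwalk_length q + 1" using l pq by (cases q) auto
    show ?thesis
      unfolding circuit_rules_def
      by (rule UnI1, rule UnI2, rule CollectI, rule exI[of _ p], rule exI[of _ q]) (intro conjI refl assms emb v w)
  qed
  then show ?thesis by (rule rule_cong)
qed

text \<open>
  A vertex that is visited twice splits a closed walk into two shorter ones.
\<close>

lemma nonembedded_closed_walk: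
  assumes IH: "\<And>d. \<lbrakk>walk d; hd d = last d; length d < length c\<rbrakk> \<Longrightarrow> lbl d \<approx> []"
    and c: "walk c" "hd c = last c" "\<not> distinct (tl c)"
  shows "lbl c \<approx> []"
proof -
  obtain x t where xt: "c = x # t" using c by (cases c) auto
  then obtain a y b e where t: "t = a @ [y] @ b @ [y] @ e"
    using c not_distinct_decomp by fastforce
  have ceq: "c = (x # a) @ y # (b @ y # e)" using xt t by simp
  have w1: "walk ((x # a) @ [y])" "walk (y # b @ y # e)" using c(1) vwalk_split ceq by metis+
  then have w2: "walk (y # b @ [y])" "walk (y # e)"
    using vwalk_split[of "y # b" y e "with_proj X"] by simp_all
  have "walk ((x # a) @ y # e)" using w1(1) w2(2) vwalk_split by metis
  moreover have "hd ((x # a) @ y # e) = last ((x # a) @ y # e)" using c(2) ceq by simp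
  ultimately have 1: "lbl ((x # a) @ y # e) \<approx> []" using IH ceq by simp
  have 2: "lbl (y # b @ [y]) \<approx> []" using IH[OF w2(1)] ceq by simp
  have "lbl c = lbl ((x # a) @ [y]) @ lbl (y # b @ [y]) @ lbl (y # e)"
    using ceq path_label_split[of L "x # a" y "b @ y # e"] path_label_split[of L "y # b" y e] by simp
  also have "\<dots> \<approx> lbl ((x # a) @ [y]) @ [] @ lbl (y # e)"
    using 2 by (rule cong_context) (use w1 w2 lbl_in in auto)
  also have "\<dots> = lbl ((x # a) @ y # e)" using path_label_split[of L "x # a" y e] by simp
  also have "\<dots> \<approx> []" by (rule 1)
  finally show ?thesis .
qed

text \<open>
  By induction on the length, only embedded circuits \<open>c\<close> need an argument.  Cut \<open>c\<close> into two
  halves \<open>p\<close> and \<open>q\<close>, as equal as possible, with the same ends.  The rules do not apply to them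
  directly, as \<open>q\<close> need not be shortlex-least; so both are compared with a shortlex-least walk \<open>s\<close> with
  the same ends.  Since \<open>s\<close> is no longer than \<open>q\<close>, the closed walk formed by either half and \<open>s\<close> is no
  longer than \<open>c\<close>.  If it is shorter, or not embedded, then the induction hypothesis applies.  Otherwise
  the lengths of the two parts agree or differ by one, and it is an instance of a rule.
\<close>

theorem lbl_closed_walk: "\<lbrakk>walk c; hd c = last c\<rbrakk> \<Longrightarrow> lbl c \<approx> []"
proof (induction "length c" arbitrary: c rule: less_induct)
  case less
  have IH: "lbl d \<approx> []" if "walk d" "hd d = last d" "length d < length c" for d
    using less.hyps that by blast
  show ?case
  proof (cases "distinct (tl c)")
    case False
    then show ?thesis using nonembedded_closed_walk[OF IH] less.prems by blast
  next
    case dist: True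
    consider "length c \<le> 1" | x y where "c = [x, y]" | x y z where "c = [x, y, z]" | "4 \<le> length c"
    proof -
      have "length c \<le> 1 \<or> length c = 2 \<or> length c = 3 \<or> 4 \<le> length c" by linarith
      then show thesis using that by (auto simp: numeral_eq_Suc length_Suc_conv)
    qed
    then show ?thesis
    proof cases
      case 1
      then show ?thesis by (cases c) auto
    next
      case (2 x y)
      then show ?thesis using less.prems arc_neq by (auto simp: vwalk_Cons_Cons)
    next
      case (3 x y z)
      then show ?thesis using less.prems lbl_back_and_forth by (auto simp: vwalk_Cons_Cons)
    next
      case 4
      let ?N = "length c - 1"
      define k where "k = (?N + 1) div 2"
      define p where "p = take (k + 1) c"
      define q where "q = rev (drop k c)"
      have k: "k < length c" "2 * k = ?N \<or> 2 * k = ?N + 1" using 4 by (auto simp: k_def)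
      have ceq: "c = take k c @ c ! k # drop (Suc k) c" using k by (simp add: id_take_nth_drop)
      have p: "p = take k c @ [c ! k]" using k by (simp add: p_def take_Suc_conv_app_nth)
      have q: "rev q = c ! k # drop (Suc k) c" using k by (simp add: q_def Cons_nth_drop_Suc)
      have join: "c = p @ tl (rev q)" using ceq p q by simp
      have "walk (take k c @ c ! k # drop (Suc k) c)" using less.prems(1) ceq by simp
      then have w: "walk p" "walk (rev q)" using p q vwalk_split by metis+
      then have w': "walk q" by simp
      have neq: "p \<noteq> []" "q \<noteq> []" using w w' walk_not_Nil by auto
      have "hd p = hd c" using join neq by simp
      moreover have "hd q = last c" using k by (simp add: q_def hd_rev)
      ultimately have hd: "hd p = hd q" using less.prems(2) by simp
      have last: "last p = last q" using p q neq by (metis last_snoc hd_rev list.sel(1))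
      have len: "length p = k + 1" "length q = ?N - k + 1" using k by (auto simp: p_def q_def)
      obtain s where s: "slex X L r s" "walk s" "hd s = hd q" "last s = last q" "length s \<le> length q"
        using ex_slex[OF w'] by blast
      have shorten: "lbl g \<approx> lbl s" if g: "walk g" "hd g = hd q" "last g = last q"
        "length g \<le> length p" "length g + length s = length c + 1 \<Longrightarrow>
          length g = length s \<or> length g = length s + 1" for g
      proof -
        have "length g + length s \<le> length c + 1" using len g(4) s(5) k 4 by linarith
        moreover have c': "walk (g @ tl (rev s))" "hd (g @ tl (rev s)) = last (g @ tl (rev s))"
        proof -
          have gs: "g \<noteq> []" "rev s \<noteq> []" "last g = hd (rev s)"
            using g s walk_not_Nil by (auto simp: hd_rev)
          show "walk (g @ tl (rev s))" using walk_join[of g "rev s"] g(1) s(2) gs by simp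
          have "last (g @ tl (rev s)) = last (rev s)"
            using vwalk_join_last[of g "rev s"] gs by (auto simp: vwalk_join_def)
          then show "hd (g @ tl (rev s)) = last (g @ tl (rev s))"
            using gs g s by (simp add: last_rev)
        qed
        moreover have "length (g @ tl (rev s)) = length g + length s - 1"
          using walk_not_Nil[OF s(2)] by (cases s) auto
        ultimately consider "length (g @ tl (rev s)) < length c"
          | "length (g @ tl (rev s)) = length c" "length g + length s = length c + 1"
          using 4 walk_not_Nil[OF s(2)] walk_not_Nil[OF g(1)] by force
        then show ?thesis
        proof cases
          case 1
          then have "lbl (g @ tl (rev s)) \<approx> []" using IH c' by blast
          then show ?thesis using lbl_cong_iff[OF g(1) s(2)] g s by simp
        next
          case 2
          show ?thesis
          proof (cases "distinct (tl (g @ tl (rev s)))")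
            case False
            then have "lbl (g @ tl (rev s)) \<approx> []"
              using nonembedded_closed_walk[OF _ c'] IH 2(1) by metis
            then show ?thesis using lbl_cong_iff[OF g(1) s(2)] g s by simp
          next
            case True
            then have "embedded_circuit X (g @ tl (rev s))"
              unfolding embedded_circuit_def using c' 2 4 by simp
            then show ?thesis
              using embedded_circuit_rule[OF g(1) s(2) _ _ s(1)] g s 2 by simp
          qed
        qed
      qed
      have "lbl p \<approx> lbl s"
        by (rule shorten[OF w(1) hd last]) (use len k in auto)
      moreover have "lbl q \<approx> lbl s"
        by (rule shorten[OF w' refl refl]) (use len k s(5) in auto)
      ultimately have "lbl p \<approx> lbl q" using cong_sym cong_trans by blast
      then show ?thesis using lbl_cong_iff[OF w(1) w' hd last] join by simp
    qed
  qed
qed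

corollary lbl_cong:
  assumes "walk p" "walk q" "hd p = hd q" "last p = last q"
  shows "lbl p \<approx> lbl q"
proof -
  have pq: "p \<noteq> []" "rev q \<noteq> []" "last p = hd (rev q)" using assms walk_not_Nil by (auto simp: hd_rev)
  have "walk (p @ tl (rev q))" using walk_join[of p "rev q"] assms pq by simp
  moreover have "last (p @ tl (rev q)) = last (rev q)"
    using vwalk_join_last[of p "rev q"] pq by (auto simp: vwalk_join_def)
  then have "hd (p @ tl (rev q)) = last (p @ tl (rev q))" using pq assms by (simp add: last_rev)
  ultimately show ?thesis using lbl_cong_iff[OF assms] lbl_closed_walk by blast
qed

end

section \<open>Normal forms\<close>

text \<open>
  By the last two assumptions the letters are precisely the orbits of arcs, so that words are sequences
  of such orbits.
\<close>

locale free_labelled_action = G: group G + circuit_rewriting X L A r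
  for G :: "('g, 'b) monoid_scheme" (structure) and X :: "'v pair_pre_digraph"
    and L :: "'v \<Rightarrow> 'v \<Rightarrow> 'x" and A r +
  fixes act :: "'g \<Rightarrow> 'v \<Rightarrow> 'v"
  assumes act_vert: "\<lbrakk>g \<in> carrier G; u \<in> pverts X\<rbrakk> \<Longrightarrow> act g u \<in> pverts X"
    and act_one: "u \<in> pverts X \<Longrightarrow> act \<one> u = u"
    and act_mult: "\<lbrakk>g \<in> carrier G; h \<in> carrier G; u \<in> pverts X\<rbrakk> \<Longrightarrow> act (g \<otimes> h) u = act g (act h u)"
    and act_free: "\<lbrakk>g \<in> carrier G; u \<in> pverts X; act g u = u\<rbrakk> \<Longrightarrow> g = \<one>"
    and act_arc: "\<lbrakk>g \<in> carrier G; (u, v) \<in> parcs X\<rbrakk> \<Longrightarrow> (act g u, act g v) \<in> parcs X"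
    and act_label: "\<lbrakk>g \<in> carrier G; (u, v) \<in> parcs X\<rbrakk> \<Longrightarrow> L (act g u) (act g v) = L u v"
    and same_label: "\<lbrakk>(u, v) \<in> parcs X; (u', v') \<in> parcs X; L u v = L u' v'\<rbrakk>
      \<Longrightarrow> \<exists>g\<in>carrier G. u' = act g u \<and> v' = act g v"
    and every_letter: "x \<in> A \<Longrightarrow> \<exists>u v. (u, v) \<in> parcs X \<and> L u v = x"
begin

lemma act_inv: "\<lbrakk>g \<in> carrier G; u \<in> pverts X\<rbrakk> \<Longrightarrow> act (inv g) (act g u) = u"
  and act_inv': "\<lbrakk>g \<in> carrier G; u \<in> pverts X\<rbrakk> \<Longrightarrow> act g (act (inv g) u) = u"
  using act_mult[of "inv g" g u] act_mult[of g "inv g" u] act_one by simp_all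

lemma act_eq_iff: "\<lbrakk>g \<in> carrier G; u \<in> pverts X; v \<in> pverts X\<rbrakk> \<Longrightarrow> act g u = act g v \<longleftrightarrow> u = v"
  using act_inv by metis

text \<open>
  The orbits of pairs of vertices are encoded as relations on vertices.  Composition in the groupoid is
  then composition of relations, and the empty composite signals that two orbits do not compose.
\<close>

definition orb :: "'v \<Rightarrow> 'v \<Rightarrow> ('v \<times> 'v) set" where
  "orb u v = {(act g u, act g v) | g. g \<in> carrier G}"

lemma orbI: "g \<in> carrier G \<Longrightarrow> (act g u, act g v) \<in> orb u v"
  by (auto simp: orb_def)

lemma orb_self: "\<lbrakk>u \<in> pverts X; v \<in> pverts X\<rbrakk> \<Longrightarrow> (u, v) \<in> orb u v"
  using orbI[of \<one> u v] act_one by simp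

lemma orb_act:
  assumes g: "g \<in> carrier G" and uv: "u \<in> pverts X" "v \<in> pverts X"
  shows "orb (act g u) (act g v) = orb u v"
proof
  show "orb (act g u) (act g v) \<subseteq> orb u v"
  proof
    fix p assume "p \<in> orb (act g u) (act g v)"
    then obtain h where "h \<in> carrier G" "p = (act h (act g u), act h (act g v))" by (auto simp: orb_def)
    then show "p \<in> orb u v" using orbI[of "h \<otimes> g" u v] g uv act_mult by simp
  qed
  show "orb u v \<subseteq> orb (act g u) (act g v)"
  proof
    fix p assume "p \<in> orb u v"
    then obtain h where h: "h \<in> carrier G" "p = (act h u, act h v)" by (auto simp: orb_def)
    have "act h y = act (h \<otimes> inv g) (act g y)" if "y \<in> pverts X" for y
      using g h that act_inv act_mult act_vert by simp
    then show "p \<in> orb (act g u) (act g v)"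
      using orbI[of "h \<otimes> inv g" "act g u" "act g v"] g h uv by simp
  qed
qed

lemma orb_eqD:
  assumes "orb u v = orb u' v'" "u \<in> pverts X" "v \<in> pverts X"
  shows "\<exists>g\<in>carrier G. u = act g u' \<and> v = act g v'"
proof -
  have "(u, v) \<in> orb u' v'" using orb_self[OF assms(2,3)] assms(1) by simp
  then show ?thesis by (auto simp: orb_def)
qed

lemma orb_eq_right:
  assumes "orb u v = orb u v'" "u \<in> pverts X" "v \<in> pverts X" "v' \<in> pverts X"
  shows "v = v'"
  using orb_eqD[OF assms(1-3)] assms act_free act_one by metis

text \<open>
  Freeness enters here: an element that matches the two copies of the middle vertex \<open>v\<close> is trivial, so
  the composite is a single orbit.
\<close>

lemma orb_relcomp:
  assumes "u \<in> pverts X" "v \<in> pverts X" "z \<in> pverts X"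
  shows "orb u v O orb v z = orb u z"
proof
  show "orb u v O orb v z \<subseteq> orb u z"
  proof
    fix p assume "p \<in> orb u v O orb v z"
    then obtain g h where gh: "g \<in> carrier G" "h \<in> carrier G" "act g v = act h v" "p = (act g u, act h z)"
      by (auto simp: orb_def)
    have "act (inv g \<otimes> h) v = act (inv g) (act g v)" using gh act_mult assms(2) by simp
    then have "act (inv g \<otimes> h) v = v" using gh act_inv[of g v] assms(2) by simp
    then have "inv g \<otimes> h = \<one>" using act_free[of "inv g \<otimes> h" v] gh assms(2) by simp
    then have "inv h = inv g" using gh G.inv_equality[of "inv g" h] by simp
    then have "g = h" using gh(1,2) by (metis G.inv_inv)
    then show "p \<in> orb u z" using gh orbI by auto
  qed
  show "orb u z \<subseteq> orb u v O orb v z" by (auto simp: orb_def)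
qed

lemma orb_subset_Id: "\<lbrakk>u \<in> pverts X; v \<in> pverts X\<rbrakk> \<Longrightarrow> orb u v \<subseteq> Id \<longleftrightarrow> u = v"
  using orb_self[of u v] by (auto simp: orb_def)

lemma orb_relcomp_empty_iff:
  assumes "b \<in> pverts X" "u \<in> pverts X"
  shows "orb a b O orb u v = {} \<longleftrightarrow> (\<forall>g\<in>carrier G. act g b \<noteq> u)"
proof
  assume empty: "orb a b O orb u v = {}"
  show "\<forall>g\<in>carrier G. act g b \<noteq> u"
  proof
    fix g assume "g \<in> carrier G"
    then have "(act g a, act g b) \<in> orb a b" "(act \<one> u, act \<one> v) \<in> orb u v" by (auto intro: orbI)
    then show "act g b \<noteq> u" using empty act_one[OF assms(2)] by auto
  qed
next
  assume ne: "\<forall>g\<in>carrier G. act g b \<noteq> u"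
  show "orb a b O orb u v = {}"
  proof (rule ccontr)
    assume "orb a b O orb u v \<noteq> {}"
    then obtain g h where gh: "g \<in> carrier G" "h \<in> carrier G" "act g b = act h u" by (auto simp: orb_def)
    then have "act (inv h \<otimes> g) b = u" using act_mult act_inv assms by simp
    then show False using ne gh by simp
  qed
qed

text \<open>
  Multiplication of a normal form by an orbit.  The last member of the sequence comes first in the
  list.
\<close>

fun push :: "('v \<times> 'v) set \<Rightarrow> ('v \<times> 'v) set list \<Rightarrow> ('v \<times> 'v) set list" where
  "push f [] = [f]"
| "push f (e # w) = (if e O f = {} then f # e # w else if e O f \<subseteq> Id then w else (e O f) # w)"

fun reduced :: "('v \<times> 'v) set list \<Rightarrow> bool" where
  "reduced [] = True"
| "reduced (f # w) \<longleftrightarrow> (\<exists>u\<in>pverts X. \<exists>v\<in>pverts X. u \<noteq> v \<and> f = orb u v) \<and> reduced w \<and>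
     (case w of [] \<Rightarrow> True | e # _ \<Rightarrow> e O f = {})"

text \<open>
  Multiplication by the orbit of \<open>(u, v)\<close>, with identities acting trivially.  Reading the label of a
  walk from \<open>u\<close> to \<open>v\<close> will have this effect.
\<close>

definition jump :: "'v \<Rightarrow> 'v \<Rightarrow> ('v \<times> 'v) set list \<Rightarrow> ('v \<times> 'v) set list" where
  "jump u v w = (if u = v then w else push (orb u v) w)"

lemma jump_self [simp]: "jump u u w = w"
  by (simp add: jump_def)

text \<open>
  Whether an orbit composes with the one before it depends only on where it starts.
\<close>

lemma jump_fresh:
  assumes red: "reduced (orb u v # w)" and V: "u \<in> pverts X" "v \<in> pverts X" "z \<in> pverts X"
  shows "jump u z w = (if u = z then w else orb u z # w)"
    and "u \<noteq> z \<Longrightarrow> reduced (orb u z # w)"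
proof -
  have *: "e O orb u z = {}" if w: "w = e # w'" for e w'
  proof -
    have "reduced (e # w')" "e O orb u v = {}" using red w by auto
    then obtain a b where "a \<in> pverts X" "b \<in> pverts X" "e = orb a b" "orb a b O orb u v = {}" by auto
    then show ?thesis using orb_relcomp_empty_iff V by simp
  qed
  show "jump u z w = (if u = z then w else orb u z # w)"
    using * by (cases w) (auto simp: jump_def)
  show "reduced (orb u z # w)" if "u \<noteq> z"
    using * red V that by (cases w) auto
qed

lemma reduced_tail: "reduced (f # w) \<Longrightarrow> reduced w"
  by simp

lemma reduced_neq:
  assumes "reduced (orb a u # w)" "a \<in> pverts X" "u \<in> pverts X"
  shows "a \<noteq> u"
proof -
  obtain b v where "b \<in> pverts X" "v \<in> pverts X" "b \<noteq> v" "orb a u = orb b v" using assms(1) by auto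
  then show ?thesis using orb_subset_Id assms(2,3) by metis
qed

text \<open>
  Either the last member of the normal form does not compose with anything that starts at \<open>u\<close>, or one
  may choose a representative of it that ends at \<open>u\<close>.
\<close>

lemma reduced_cases [consumes 2, case_names separate merge]:
  assumes "reduced w" "u \<in> pverts X"
  obtains "\<And>v. v \<in> pverts X \<Longrightarrow> u \<noteq> v \<Longrightarrow> jump u v w = orb u v # w \<and> reduced (orb u v # w)"
    | a w' where "a \<in> pverts X" "a \<noteq> u" "w = orb a u # w'"
proof (cases w)
  case Nil
  then show thesis using that(1) assms by (auto simp: jump_def)
next
  case (Cons e w')
  then obtain a b where ab: "a \<in> pverts X" "b \<in> pverts X" "a \<noteq> b" "e = orb a b" using assms by auto
  show thesis
  proof (cases "\<exists>g\<in>carrier G. act g b = u")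
    case True
    then obtain g where g: "g \<in> carrier G" "act g b = u" by blast
    then have "e = orb (act g a) u" "act g a \<noteq> u" "act g a \<in> pverts X"
      using ab orb_act act_eq_iff act_vert by metis+
    then show thesis using that(2) Cons by blast
  next
    case False
    then have "e O orb u v = {}" for v using orb_relcomp_empty_iff[OF ab(2) assms(2)] ab(4) by blast
    then show thesis using that(1) Cons assms by (auto simp: jump_def)
  qed
qed

lemma jump_merge:
  assumes "a \<in> pverts X" "u \<in> pverts X" "v \<in> pverts X" "reduced (orb a u # w)"
  shows "jump u v (orb a u # w) = jump a v w"
proof (cases "u = v")
  case True
  then show ?thesis
    using jump_fresh(1)[OF assms(4,1,2,2)] reduced_neq[OF assms(4,1,2)] by simp
next
  case False
  have "orb a v \<noteq> {}" using orb_self assms by blast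
  then have "push (orb u v) (orb a u # w) = (if a = v then w else orb a v # w)"
    using orb_relcomp[OF assms(1-3)] orb_subset_Id[OF assms(1,3)] by simp
  then show ?thesis using jump_fresh(1)[OF assms(4,1,2,3)] False by (simp add: jump_def)
qed

lemma reduced_jump:
  assumes "reduced w" "u \<in> pverts X" "v \<in> pverts X"
  shows "reduced (jump u v w)"
  using assms(1,2)
proof (cases rule: reduced_cases)
  case separate
  then show ?thesis using assms by (cases "u = v") auto
next
  case (merge a w')
  then show ?thesis
    using assms jump_merge[of a u v w'] jump_fresh[of a u w' v] by (auto simp del: reduced.simps intro: reduced_tail)
qed

text \<open>
  Normal forms carry an action of the groupoid.  The case to watch is that the first factor cancels the
  last member completely: the member uncovered by this does not compose with the second factor, since
  it did not compose with the cancelled one, which starts at the same vertex up to the group.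
\<close>

theorem jump_jump:
  assumes w: "reduced w" and V: "u \<in> pverts X" "v \<in> pverts X" "z \<in> pverts X"
  shows "jump v z (jump u v w) = jump u z w"
  using w V(1)
proof (cases rule: reduced_cases)
  case separate
  show ?thesis
  proof (cases "u = v")
    case False
    then show ?thesis using separate[OF V(2)] jump_merge[OF V] by simp
  qed simp
next
  case (merge a w')
  have red: "reduced (orb a u # w')" using merge w by simp
  have uv: "jump u v w = jump a v w'" "jump u z w = jump a z w'"
    using jump_merge[OF merge(1) V(1) _ red] V merge(3) by simp_all
  show ?thesis
  proof (cases "a = v")
    case False
    then show ?thesis
      using uv jump_fresh[OF red merge(1) V(1,2)] jump_merge[OF merge(1) V(2,3)] by simp
  qed (use uv in simp)
qed

definition letter_orb :: "'x \<Rightarrow> ('v \<times> 'v) set" where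
  "letter_orb x = {(u, v) \<in> parcs X. L u v = x}"

lemma letter_orb_arc:
  assumes "(u, v) \<in> parcs X"
  shows "letter_orb (L u v) = orb u v"
proof
  show "letter_orb (L u v) \<subseteq> orb u v"
  proof
    fix p assume "p \<in> letter_orb (L u v)"
    then obtain u' v' where "(u', v') \<in> parcs X" "L u' v' = L u v" "p = (u', v')"
      by (auto simp: letter_orb_def)
    then show "p \<in> orb u v" using same_label[OF assms, of u' v'] by (auto simp: orb_def)
  qed
  show "orb u v \<subseteq> letter_orb (L u v)"
    using assms act_arc act_label by (auto simp: orb_def letter_orb_def)
qed

definition run :: "'x list \<Rightarrow> ('v \<times> 'v) set list \<Rightarrow> ('v \<times> 'v) set list" where
  "run s w = fold (\<lambda>x. push (letter_orb x)) s w"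

lemma run_simps [simp]: "run [] w = w" "run (x # s) w = run s (push (letter_orb x) w)"
  "run (s @ t) w = run t (run s w)"
  by (simp_all add: run_def)

lemma push_letter: "(u, v) \<in> parcs X \<Longrightarrow> push (letter_orb (L u v)) w = jump u v w"
  using arc_neq by (auto simp: letter_orb_arc jump_def)

lemma reduced_run: "s \<in> lists A \<Longrightarrow> reduced w \<Longrightarrow> reduced (run s w)"
proof (induction s arbitrary: w)
  case (Cons x s)
  then obtain u v where "(u, v) \<in> parcs X" "x = L u v" using every_letter by force
  then have "reduced (push (letter_orb x) w)"
    using push_letter reduced_jump Cons.prems(2) in_arcsD1 in_arcsD2 by metis
  then show ?case using Cons by simp
qed simp

lemma run_walk: "walk p \<Longrightarrow> reduced w \<Longrightarrow> run (lbl p) w = jump (hd p) (last p) w"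
proof (induction p arbitrary: w)
  case (Cons u p)
  show ?case
  proof (cases p)
    case (Cons v q)
    then have uv: "(u, v) \<in> parcs X" "walk p" "last p \<in> pverts X"
      using Cons.prems by (auto simp: vwalk_Cons_Cons vwalk_def)
    note V = in_arcsD1[OF uv(1)] in_arcsD2[OF uv(1)]
    have "run (lbl (u # p)) w = run (lbl p) (jump u v w)" using Cons push_letter[OF uv(1)] by simp
    also have "\<dots> = jump v (last p) (jump u v w)"
      using Cons.IH[OF uv(2) reduced_jump[OF Cons.prems(2) V]] Cons by simp
    also have "\<dots> = jump u (last p) w" using jump_jump[OF Cons.prems(2) V uv(3)] .
    finally show ?thesis using Cons by simp
  qed simp
qed (simp add: vwalk_def)

lemma circuit_rule_walks:
  assumes "(s, t) \<in> circuit_rules X L r"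
  obtains p q where "walk p" "walk q" "hd p = hd q" "last p = last q" "s = lbl p" "t = lbl q"
proof -
  consider u v where "(u, v) \<in> parcs X" "s = lbl [u, v, u]" "t = []"
    | p q where "walk p" "walk q" "hd p = hd q" "last p = last q" "s = lbl p" "t = lbl q"
    using assms unfolding circuit_rules_def by blast
  then show thesis
  proof cases
    case (1 u v)
    then have "walk [u, v, u]" "walk [u]"
      using arc_sym in_arcsD1 in_arcsD2 by (auto simp: vwalk_def)
    then show thesis using that[of "[u, v, u]" "[u]"] 1 by simp
  qed (rule that)
qed

lemma run_cong: "s \<approx> t \<Longrightarrow> reduced w \<Longrightarrow> run s w = run t w"
  unfolding cong_def
proof (induction rule: equivclp_induct)
  case (step y z)
  have "run a w = run b w" if ab: "rewrite_step RS a b" for a b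
  proof -
    obtain u l r' v where e: "(l, r') \<in> circuit_rules X L r" "u \<in> lists A" "a = u @ l @ v" "b = u @ r' @ v"
      using ab by (auto simp: rewrite_step_def)
    have "reduced (run u w)" using reduced_run[OF e(2) step.prems] .
    then have "run l (run u w) = run r' (run u w)"
      using circuit_rule_walks[OF e(1)] run_walk by metis
    then show ?thesis using e by simp
  qed
  then show ?case using step by metis
qed simp

lemma walk_act:
  assumes g: "g \<in> carrier G"
  shows "walk p \<Longrightarrow> walk (map (act g) p) \<and> lbl (map (act g) p) = lbl p"
proof (induction p)
  case (Cons u p)
  show ?case
  proof (cases p)
    case Nil
    then show ?thesis using Cons.prems act_vert[OF g] by (simp add: vwalk_def)
  next
    case (Cons v q)
    then show ?thesis
      using Cons.IH Cons.prems act_arc[OF g] act_label[OF g] act_vert[OF g] by (simp add: vwalk_Cons_Cons)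
  qed
qed (simp add: vwalk_def)

lemma ex_walk:
  assumes "u \<in> pverts X" "v \<in> pverts X"
  obtains p where "walk p" "hd p = u" "last p = v"
proof -
  have "pair_wf_digraph X" ..
  then show thesis
    using relpow_imp_path_between[OF _ assms(1) relpow_gdist[OF assms]] that
    unfolding path_between_def by blast
qed

definition orb_word :: "('v \<times> 'v) set \<Rightarrow> 'x list" where
  "orb_word f = (SOME s. \<exists>p. walk p \<and> f = orb (hd p) (last p) \<and> s = lbl p)"

text \<open>
  The chosen walk represents the same orbit as \<open>p\<close>, so a translate of it has the same ends as \<open>p\<close>,
  and the labels of translates are equal.
\<close>

lemma orb_word:
  assumes p: "walk p"
  shows "orb_word (orb (hd p) (last p)) \<approx> lbl p" "orb_word (orb (hd p) (last p)) \<in> lists A"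
proof -
  have V: "hd p \<in> pverts X" "last p \<in> pverts X" using p by (auto simp: vwalk_def)
  have "\<exists>s. \<exists>q. walk q \<and> orb (hd p) (last p) = orb (hd q) (last q) \<and> s = lbl q" using p by blast
  then have "\<exists>q. walk q \<and> orb (hd p) (last p) = orb (hd q) (last q) \<and> orb_word (orb (hd p) (last p)) = lbl q"
    unfolding orb_word_def by (rule someI_ex)
  then obtain q where q: "walk q" "orb (hd p) (last p) = orb (hd q) (last q)"
      "orb_word (orb (hd p) (last p)) = lbl q" by blast
  obtain g where g: "g \<in> carrier G" "hd p = act g (hd q)" "last p = act g (last q)"
    using orb_eqD[OF q(2) V] by blast
  have "q \<noteq> []" using walk_not_Nil q(1) .
  then have "lbl (map (act g) q) \<approx> lbl p"
    using lbl_cong[of "map (act g) q" p] walk_act[OF g(1) q(1)] p g by (simp add: hd_map last_map)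
  then show "orb_word (orb (hd p) (last p)) \<approx> lbl p" "orb_word (orb (hd p) (last p)) \<in> lists A"
    using q walk_act[OF g(1) q(1)] by simp_all
qed

text \<open>
  A word for each normal form, used to show that a word is determined by its normal form up to
  equivalence.
\<close>

primrec spell :: "('v \<times> 'v) set list \<Rightarrow> 'x list" where
  "spell [] = []"
| "spell (f # w) = spell w @ orb_word f"

lemma spell_in: "reduced w \<Longrightarrow> spell w \<in> lists A"
proof (induction w)
  case (Cons f w)
  then obtain u v where uv: "u \<in> pverts X" "v \<in> pverts X" "f = orb u v" by auto
  then obtain p where "walk p" "hd p = u" "last p = v" using ex_walk by metis
  then have "orb_word f \<in> lists A" using orb_word(2) uv(3) by blast
  then show ?case using Cons by simp
qed simp

lemma spell_jump:
  assumes w: "reduced w" and p: "walk p"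
  shows "spell (jump (hd p) (last p) w) \<approx> spell w @ lbl p"
proof -
  define u v where "u = hd p" "v = last p"
  have V: "u \<in> pverts X" "v \<in> pverts X" using p by (auto simp: vwalk_def u_v_def)
  have p': "orb_word (orb u v) \<approx> lbl p" "orb_word (orb u v) \<in> lists A" "lbl p \<in> lists A"
    using orb_word[OF p] p by (simp_all add: u_v_def)
  have closed: "lbl q \<approx> []" if "walk q" "hd q = last q" for q
    using lbl_closed_walk that .
  have "spell (jump u v w) \<approx> spell w @ lbl p"
    using w V(1)
  proof (cases rule: reduced_cases)
    case separate
    show ?thesis
    proof (cases "u = v")
      case True
      then have "spell w @ [] \<approx> spell w @ lbl p"
        using cong_append[OF cong_refl cong_sym[OF closed[OF p]]] spell_in[OF w] p'(3) u_v_def by metis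
      then show ?thesis using True by simp
    next
      case False
      then show ?thesis
        using separate[OF V(2)] cong_append[OF cong_refl p'(1) spell_in[OF w] p'(3)] by simp
    qed
  next
    case (merge a w')
    have red: "reduced (orb a u # w')" using merge w by simp
    then have w': "spell w' \<in> lists A" by (simp add: spell_in)
    obtain q where q: "walk q" "hd q = a" "last q = u" using ex_walk merge(1) V(1) by metis
    have qp: "walk (q @ tl p)" "hd (q @ tl p) = a" "last (q @ tl p) = v"
    proof -
      have ne: "q \<noteq> []" "p \<noteq> []" using q(1) p walk_not_Nil by auto
      show "walk (q @ tl p)" using walk_join[OF q(1) p] q by (simp add: u_v_def)
      show "hd (q @ tl p) = a" using ne q by simp
      show "last (q @ tl p) = v"
        using vwalk_join_last[of q p] ne q by (auto simp: vwalk_join_def u_v_def)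
    qed
    have lqp: "lbl (q @ tl p) = lbl q @ lbl p"
      using path_label_join[of q p L] q p walk_not_Nil by (simp add: u_v_def)
    have "spell w = spell w' @ orb_word (orb a u)" using merge by simp
    moreover have "spell w' @ orb_word (orb a u) \<approx> spell w' @ lbl q"
      using cong_append[OF cong_refl] orb_word[OF q(1)] w' q by simp
    ultimately have "spell w @ lbl p \<approx> (spell w' @ lbl q) @ lbl p"
      using cong_append[OF _ cong_refl] spell_in[OF w] p'(3) by metis
    then have 1: "spell w @ lbl p \<approx> spell w' @ lbl (q @ tl p)" using lqp by simp
    have 2: "spell (jump a v w') \<approx> spell w' @ lbl (q @ tl p)"
    proof (cases "a = v")
      case True
      then have "spell w' @ [] \<approx> spell w' @ lbl (q @ tl p)"
        using cong_append[OF cong_refl cong_sym[OF closed[OF qp(1)]]] w' qp lbl_in by metis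
      then show ?thesis using True by simp
    next
      case False
      then show ?thesis
        using jump_fresh(1)[OF red merge(1) V] cong_append[OF cong_refl] orb_word[OF qp(1)] w' qp by simp
    qed
    show ?thesis
      using jump_merge[OF merge(1) V red] merge(3) 1 2 cong_sym cong_trans by metis
  qed
  then show ?thesis by (simp add: u_v_def)
qed

abbreviation "nf s \<equiv> run s []"

lemma spell_nf: "s \<in> lists A \<Longrightarrow> spell (nf s) \<approx> s"
proof (induction s rule: rev_induct)
  case (snoc x s)
  obtain u v where uv: "(u, v) \<in> parcs X" "x = L u v" using every_letter snoc.prems by force
  then have p: "walk [u, v]" using in_arcsD1 in_arcsD2 by (auto simp: vwalk_def)
  have s: "s \<in> lists A" "x \<in> A" using snoc.prems by auto
  have "nf (s @ [x]) = jump (hd [u, v]) (last [u, v]) (nf s)" using push_letter uv by simp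
  then have "spell (nf (s @ [x])) \<approx> spell (nf s) @ [x]"
    using spell_jump[OF reduced_run[OF s(1)] p] uv by simp
  also have "\<dots> \<approx> s @ [x]"
    using cong_append[OF snoc.IH[OF s(1)] cong_refl] s spell_in reduced_run by simp
  finally show ?case .
qed simp

text \<open>
  One direction holds because the rules respect normal forms, the other because each word is equivalent
  to the one spelled by its normal form.
\<close>

theorem cong_iff_nf:
  assumes "s \<in> lists A" "t \<in> lists A"
  shows "s \<approx> t \<longleftrightarrow> nf s = nf t"
proof
  assume "nf s = nf t"
  then show "s \<approx> t" using spell_nf[OF assms(1)] spell_nf[OF assms(2)] cong_sym cong_trans by metis
qed (simp add: run_cong)

section \<open>The length of a normal form\<close>

lemma gdist_act:
  assumes g: "g \<in> carrier G" and V: "u \<in> pverts X" "v \<in> pverts X"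
  shows "gdist X (act g u) (act g v) = gdist X u v"
proof (rule gdist_eqI[OF V(1) _ _ _ V(2)])
  show "gdist X (act g u) (act g w) \<le> gdist X (act g u) (act g v) + 1" if "(v, w) \<in> parcs X" for v w
    using gdist_step[OF act_vert[OF g V(1)] act_arc[OF g that]] .
  show "\<exists>w. (w, v) \<in> parcs X \<and> gdist X (act g u) (act g v) = gdist X (act g u) (act g w) + 1"
    if v: "v \<in> pverts X" "v \<noteq> u" for v
  proof -
    have "act g v \<noteq> act g u" using act_eq_iff[OF g] v V by simp
    then obtain w where w: "(w, act g v) \<in> parcs X" "gdist X (act g u) (act g v) = gdist X (act g u) w + 1"
      using gdist_pred act_vert[OF g] v V by metis
    have "(act (inv g) w, v) \<in> parcs X" using act_arc[OF _ w(1), of "inv g"] act_inv[OF g v(1)] g by simp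
    moreover have "act g (act (inv g) w) = w" using act_inv'[OF g in_arcsD1[OF w(1)]] .
    ultimately show ?thesis using w(2) by metis
  qed
qed simp

text \<open>
  The distance of a representative; by \<open>gdist_act\<close> the choice does not matter.
\<close>

definition orb_dist :: "('v \<times> 'v) set \<Rightarrow> nat" where
  "orb_dist f = (SOME d. \<exists>u\<in>pverts X. \<exists>v\<in>pverts X. f = orb u v \<and> d = gdist X u v)"

lemma orb_dist_orb [simp]:
  assumes "u \<in> pverts X" "v \<in> pverts X"
  shows "orb_dist (orb u v) = gdist X u v"
proof -
  have "\<exists>d. \<exists>u'\<in>pverts X. \<exists>v'\<in>pverts X. orb u v = orb u' v' \<and> d = gdist X u' v'" using assms by blast
  then have "\<exists>u'\<in>pverts X. \<exists>v'\<in>pverts X. orb u v = orb u' v' \<and> orb_dist (orb u v) = gdist X u' v'"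
    unfolding orb_dist_def by (rule someI_ex)
  then obtain u' v' where uv: "u' \<in> pverts X" "v' \<in> pverts X" "orb u v = orb u' v'"
      "orb_dist (orb u v) = gdist X u' v'" by blast
  then show ?thesis using orb_eqD[OF uv(3) assms] gdist_act by metis
qed

definition nf_length :: "('v \<times> 'v) set list \<Rightarrow> nat" where
  "nf_length w = sum_list (map orb_dist w)"

lemma nf_length_simps [simp]: "nf_length [] = 0" "nf_length (f # w) = orb_dist f + nf_length w"
  by (simp_all add: nf_length_def)

lemma nf_length_fresh:
  assumes "reduced (orb u v # w)" "u \<in> pverts X" "v \<in> pverts X" "z \<in> pverts X"
  shows "nf_length (jump u z w) = gdist X u z + nf_length w"
  using jump_fresh(1)[OF assms] assms by simp

lemma nf_length_step:
  assumes w: "reduced w" and uv: "(u, v) \<in> parcs X"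
  shows "nf_length (jump u v w) \<le> nf_length w + 1"
proof -
  note V = in_arcsD1[OF uv] in_arcsD2[OF uv]
  have d: "gdist X u v \<le> 1" using gdist_step[OF V(1) uv] by simp
  from w V(1) show ?thesis
  proof (cases rule: reduced_cases)
    case separate
    then show ?thesis using V(2) arc_neq[OF uv] V d by simp
  next
    case (merge a w')
    have red: "reduced (orb a u # w')" using merge w by simp
    show ?thesis
      using jump_merge[OF merge(1) V red] nf_length_fresh[OF red merge(1) V] merge V
        gdist_step[OF merge(1) uv] by simp
  qed
qed

lemma nf_top:
  assumes "s \<in> lists A" "nf s \<noteq> []"
  obtains u v w where "u \<in> pverts X" "v \<in> pverts X" "u \<noteq> v" "nf s = orb u v # w" "reduced (orb u v # w)"
proof -
  have "reduced (nf s)" using reduced_run assms(1) by simp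
  then show thesis using that assms(2) by (cases "nf s") auto
qed

lemma nf_snoc_letter:
  assumes "s \<in> lists A" "(u, v) \<in> parcs X"
  shows "nf (s @ [L u v]) = jump u v (nf s)"
  using push_letter[OF assms(2)] by simp

text \<open>
  Append the letter that leads from the end \<open>v\<close> of the last member to a predecessor of \<open>v\<close>.
\<close>

lemma ex_nf_predecessor:
  assumes s: "s \<in> lists A" "nf s \<noteq> []"
  obtains t x where "t \<in> lists A" "x \<in> A" "t @ [x] \<approx> s" "nf_length (nf s) = nf_length (nf t) + 1"
proof -
  obtain u v w where uv: "u \<in> pverts X" "v \<in> pverts X" "u \<noteq> v" "nf s = orb u v # w" "reduced (orb u v # w)"
    using nf_top[OF s] .
  obtain y where y: "(y, v) \<in> parcs X" "gdist X u v = gdist X u y + 1"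
    using gdist_pred[OF uv(1,2)] uv(3) by metis
  note vy = arc_sym[OF y(1)]
  let ?t = "s @ [L v y]"
  have t: "?t \<in> lists A" using s(1) L_in[OF vy] by simp
  have "nf ?t = jump u y w"
    using nf_snoc_letter[OF s(1) vy] jump_merge[OF uv(1,2) in_arcsD1[OF y(1)] uv(5)] uv(4) by simp
  then have len: "nf_length (nf s) = nf_length (nf ?t) + 1"
    using nf_length_fresh[OF uv(5,1,2) in_arcsD1[OF y(1)]] y(2) uv by simp
  have "nf (?t @ [L y v]) = jump y v (jump v y (nf s))"
    using nf_snoc_letter[OF t y(1)] nf_snoc_letter[OF s(1) vy] by simp
  also have "\<dots> = nf s"
    using jump_jump[OF reduced_run[OF s(1)] uv(2) in_arcsD1[OF y(1)] uv(2), of "[]"] by simp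
  finally have "?t @ [L y v] \<approx> s" using cong_iff_nf t s(1) L_in[OF y(1)] by simp
  then show thesis using that[OF t L_in[OF y(1)] _ len] by simp
qed

text \<open>
  Conversely, undoing the letter \<open>x\<close> must act on the last member of the normal form: appending a new
  member would make the normal form longer.
\<close>

lemma nf_predecessor:
  assumes t: "t \<in> lists A" "x \<in> A"
    and V: "u \<in> pverts X" "v \<in> pverts X"
    and top: "nf (t @ [x]) = orb u v # w"
    and len: "nf_length (nf (t @ [x])) = nf_length (nf t) + 1"
  obtains y where "(y, v) \<in> parcs X" "gdist X u v = gdist X u y + 1" "nf t = jump u y w"
proof -
  obtain a b where ab: "(a, b) \<in> parcs X" "x = L a b" using every_letter t(2) by blast
  note ba = in_arcsD1[OF ab(1)] in_arcsD2[OF ab(1)]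
  have red: "reduced (orb u v # w)" using reduced_run[of "t @ [x]" "[]"] t top by simp
  have "nf t = jump b a (jump a b (nf t))"
    using jump_jump[OF reduced_run[OF t(1)] ba(1,2,1), of "[]"] by simp
  then have nft: "nf t = jump b a (orb u v # w)" using top nf_snoc_letter[OF t(1) ab(1)] ab(2) by simp
  have meet: "orb u v O orb b a \<noteq> {}"
  proof
    assume "orb u v O orb b a = {}"
    then have "nf t = orb b a # orb u v # w" using nft arc_neq[OF ab(1)] by (simp add: jump_def)
    then show False using len top by simp
  qed
  then obtain g where g: "g \<in> carrier G" "act g v = b" using orb_relcomp_empty_iff[OF V(2) ba(2)] by blast
  let ?y = "act (inv g) a"
  have v: "act (inv g) b = v" using g act_inv V by auto
  then have y: "(?y, v) \<in> parcs X" using act_arc[OF _ ab(1), of "inv g"] g by simp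
  have "orb b a = orb v ?y" using orb_act[of "inv g" b a] g ba v by simp
  then have "jump b a (orb u v # w) = jump v ?y (orb u v # w)"
    using arc_neq[OF ab(1)] arc_neq[OF y] by (simp add: jump_def)
  then have nft': "nf t = jump u ?y w" using nft jump_merge[OF V in_arcsD1[OF y] red] by simp
  moreover have "gdist X u v = gdist X u ?y + 1"
    using len top nft' nf_length_fresh[OF red V in_arcsD1[OF y]] V by simp
  ultimately show thesis using that[OF y] by blast
qed

end

section \<open>The Cayley graph of the presented group\<close>

lemma connected_graph_cayley:
  assumes G: "group G" and S: "finite_inverse_closed_generating_set G S"
  shows "connected_graph (cayley_graph G S)"
proof -
  interpret G: group G by fact
  interpret pair_bidirected_digraph "cayley_graph G S"
    by (rule pair_bidirected_cayley_graph[OF G S])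
  have SG: "S \<subseteq> carrier G" and gen: "generate G S = carrier G" and inv: "m_inv G ` S = S"
    using S by (auto simp: finite_inverse_closed_generating_set_def)
  let ?R = "parcs (cayley_graph G S)"
  have arc: "(x, x \<otimes>\<^bsub>G\<^esub> s) \<in> ?R" if "x \<in> carrier G" "s \<in> S" for x s
    using that SG by (auto simp: cayley_graph_def cayley_label_def G.m_assoc[symmetric])
  have reach: "(x, x \<otimes>\<^bsub>G\<^esub> g) \<in> ?R\<^sup>*" if "g \<in> generate G S" "x \<in> carrier G" for x g
    using that
  proof (induction arbitrary: x)
    case (incl h)
    then show ?case using arc by blast
  next
    case (inv h)
    then have "inv\<^bsub>G\<^esub> h \<in> S" using \<open>m_inv G ` S = S\<close> by blast
    then show ?case using arc inv.prems by blast
  next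
    case (eng g h)
    then have gh: "g \<in> carrier G" "h \<in> carrier G" using gen by auto
    have "(x, x \<otimes>\<^bsub>G\<^esub> g) \<in> ?R\<^sup>*" "(x \<otimes>\<^bsub>G\<^esub> g, x \<otimes>\<^bsub>G\<^esub> g \<otimes>\<^bsub>G\<^esub> h) \<in> ?R\<^sup>*"
      using eng gh by auto
    then show ?case using gh eng.prems by (simp add: G.m_assoc)
  qed simp
  show ?thesis
  proof
    show "pverts (cayley_graph G S) \<noteq> {}" by (auto simp: cayley_graph_def)
    fix u v assume "u \<in> pverts (cayley_graph G S)" "v \<in> pverts (cayley_graph G S)"
    then have uv: "u \<in> carrier G" "v \<in> carrier G" by (auto simp: cayley_graph_def)
    have "u \<otimes>\<^bsub>G\<^esub> (inv\<^bsub>G\<^esub> u \<otimes>\<^bsub>G\<^esub> v) = v" using uv by (simp add: G.m_assoc[symmetric])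
    then show "(u, v) \<in> ?R\<^sup>*" using reach[of "inv\<^bsub>G\<^esub> u \<otimes>\<^bsub>G\<^esub> v" u] gen uv by simp
  qed
qed

context free_labelled_action
begin

abbreviation "M \<equiv> rewriting_monoid RS"
abbreviation "Z \<equiv> rewriting_letters RS"
abbreviation "Cay \<equiv> cayley_graph M Z"

definition cls :: "'x list \<Rightarrow> 'x list set" where
  "cls s = rewrite_equiv RS `` {s}"

lemma cls_eq: "s \<in> lists A \<Longrightarrow> cls s = {t \<in> lists A. s \<approx> t}"
  by (auto simp: cls_def rewrite_equiv_def cong_def)

lemma cls_eq_iff: "\<lbrakk>s \<in> lists A; t \<in> lists A\<rbrakk> \<Longrightarrow> cls s = cls t \<longleftrightarrow> s \<approx> t"
  unfolding cls_eq using cong_refl cong_sym cong_trans by blast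

lemma carrier_M: "carrier M = cls ` lists A"
  by (auto simp: rewriting_monoid_def quotient_def cls_def)

lemma cls_in [simp]: "s \<in> lists A \<Longrightarrow> cls s \<in> carrier M"
  by (simp add: carrier_M)

lemma one_M: "\<one>\<^bsub>M\<^esub> = cls []"
  by (simp add: rewriting_monoid_def cls_def)

lemma mult_M:
  assumes "s \<in> lists A" "t \<in> lists A"
  shows "cls s \<otimes>\<^bsub>M\<^esub> cls t = cls (s @ t)"
proof -
  have eq: "cls (s' @ t') = cls (s @ t)" if "s' \<in> cls s" "t' \<in> cls t" for s' t'
  proof -
    have *: "s' \<in> lists A" "t' \<in> lists A" "s \<approx> s'" "t \<approx> t'" using that assms by (simp_all add: cls_eq)
    then have "s @ t \<approx> s' @ t'" using cong_append assms by blast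
    then have "cls (s @ t) = cls (s' @ t')" using cls_eq_iff assms * by simp
    then show ?thesis by simp
  qed
  have "s \<in> cls s" "t \<in> cls t" using assms by (simp_all add: cls_eq)
  moreover have "cls s \<otimes>\<^bsub>M\<^esub> cls t = (\<Union>s'\<in>cls s. \<Union>t'\<in>cls t. cls (s' @ t'))"
    by (simp add: rewriting_monoid_def cls_def)
  ultimately show ?thesis using eq by blast
qed

text \<open>
  The arc \<open>(v, u)\<close> carries a letter inverse to that of \<open>(u, v)\<close>.
\<close>

lemma ex_inverse_word: "s \<in> lists A \<Longrightarrow> \<exists>t\<in>lists A. t @ s \<approx> []"
proof (induction s)
  case (Cons x s)
  then obtain t where t: "t \<in> lists A" "t @ s \<approx> []" by auto
  obtain u v where uv: "(u, v) \<in> parcs X" "x = L u v" using every_letter Cons.prems by force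
  have vu: "L v u \<in> A" using L_in arc_sym uv(1) by blast
  have "t @ [L v u, x] @ s \<approx> t @ [] @ s"
    using lbl_back_and_forth[OF arc_sym[OF uv(1)]] uv(2) by (intro cong_context) (use t Cons.prems in auto)
  also have "\<dots> \<approx> []" using t by simp
  finally have "(t @ [L v u]) @ x # s \<approx> []" by simp
  then show ?case using t(1) vu by (intro bexI[of _ "t @ [L v u]"]) auto
qed (intro bexI[of _ "[]"], simp_all)

lemma group_M: "group M"
proof (rule groupI)
  fix x y z assume "x \<in> carrier M" "y \<in> carrier M" "z \<in> carrier M"
  then obtain s t w where "s \<in> lists A" "t \<in> lists A" "w \<in> lists A" "x = cls s" "y = cls t" "z = cls w"
    by (auto simp: carrier_M)
  then show "x \<otimes>\<^bsub>M\<^esub> y \<otimes>\<^bsub>M\<^esub> z = x \<otimes>\<^bsub>M\<^esub> (y \<otimes>\<^bsub>M\<^esub> z)"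
    by (simp add: mult_M)
next
  fix x assume "x \<in> carrier M"
  then obtain s where s: "s \<in> lists A" "x = cls s" by (auto simp: carrier_M)
  obtain t where t: "t \<in> lists A" "t @ s \<approx> []" using ex_inverse_word[OF s(1)] by blast
  have "cls (t @ s) = cls []" using cls_eq_iff[of "t @ s" "[]"] s t by simp
  then show "\<exists>y\<in>carrier M. y \<otimes>\<^bsub>M\<^esub> x = \<one>\<^bsub>M\<^esub>"
    using s t by (intro bexI[of _ "cls t"]) (simp_all add: mult_M one_M)
next
  fix x y assume "x \<in> carrier M" "y \<in> carrier M"
  then obtain s t where "s \<in> lists A" "t \<in> lists A" "x = cls s" "y = cls t" by (auto simp: carrier_M)
  then show "x \<otimes>\<^bsub>M\<^esub> y \<in> carrier M" "\<one>\<^bsub>M\<^esub> \<otimes>\<^bsub>M\<^esub> x = x"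
    by (simp_all add: mult_M one_M)
qed (simp add: one_M)

sublocale M: group M
  by (rule group_M)

lemma Z_eq: "Z = (\<lambda>x. cls [x]) ` A"
  by (simp add: rewriting_letters_def cls_def)

lemma inv_letter:
  assumes "(u, v) \<in> parcs X"
  shows "inv\<^bsub>M\<^esub> cls [L u v] = cls [L v u]"
proof (rule M.inv_equality)
  have "L u v \<in> A" "L v u \<in> A" using L_in arc_sym assms by blast+
  then show "cls [L v u] \<otimes>\<^bsub>M\<^esub> cls [L u v] = \<one>\<^bsub>M\<^esub>" "cls [L u v] \<in> carrier M" "cls [L v u] \<in> carrier M"
    using lbl_back_and_forth[OF arc_sym[OF assms]] cls_eq_iff[of "[L v u, L u v]" "[]"]
    by (simp_all add: mult_M one_M)
qed

lemma generating_Z: "finite_inverse_closed_generating_set M Z"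
  unfolding finite_inverse_closed_generating_set_def
proof (intro conjI)
  show "finite Z" using finite_A by (simp add: Z_eq)
  show ZM: "Z \<subseteq> carrier M" by (auto simp: Z_eq)
  show "generate M Z = carrier M"
  proof
    show "generate M Z \<subseteq> carrier M" using M.generate_incl[OF ZM] .
    have "cls s \<in> generate M Z" if "s \<in> lists A" for s
      using that
    proof (induction s)
      case Nil
      then show ?case using generate.one[of M Z] by (simp add: one_M)
    next
      case (Cons x s)
      then have "cls [x] \<in> Z" "cls s \<in> generate M Z" by (auto simp: Z_eq)
      then have "cls [x] \<otimes>\<^bsub>M\<^esub> cls s \<in> generate M Z"
        by (blast intro: generate.eng generate.incl)
      then show ?case using Cons by (simp add: mult_M)
    qed
    then show "carrier M \<subseteq> generate M Z" by (auto simp: carrier_M)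
  qed
  show "\<one>\<^bsub>M\<^esub> \<notin> Z"
  proof
    assume "\<one>\<^bsub>M\<^esub> \<in> Z"
    then obtain x where "x \<in> A" "cls [] = cls [x]" by (auto simp: Z_eq one_M)
    then have "nf [] = nf [x]" using cls_eq_iff[of "[]" "[x]"] cong_iff_nf[of "[]" "[x]"] by simp
    then show False by simp
  qed
  show "m_inv M ` Z = Z"
  proof -
    have letter: "\<exists>y\<in>A. inv\<^bsub>M\<^esub> cls [x] = cls [y] \<and> inv\<^bsub>M\<^esub> cls [y] = cls [x]" if "x \<in> A" for x
    proof -
      obtain u v where uv: "(u, v) \<in> parcs X" "L u v = x" using every_letter \<open>x \<in> A\<close> by blast
      then show ?thesis using inv_letter arc_sym L_in by metis
    qed
    show ?thesis
    proof
      show "m_inv M ` Z \<subseteq> Z"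
      proof
        fix z assume "z \<in> m_inv M ` Z"
        then obtain x where x: "x \<in> A" "z = inv\<^bsub>M\<^esub> cls [x]" unfolding Z_eq by blast
        obtain y where "y \<in> A" "inv\<^bsub>M\<^esub> cls [x] = cls [y]" using letter[OF x(1)] by blast
        then show "z \<in> Z" unfolding Z_eq x(2) by simp
      qed
      show "Z \<subseteq> m_inv M ` Z"
      proof
        fix z assume "z \<in> Z"
        then obtain x where x: "x \<in> A" "z = cls [x]" unfolding Z_eq by blast
        obtain y where "y \<in> A" "inv\<^bsub>M\<^esub> cls [y] = cls [x]" using letter[OF x(1)] by blast
        then show "z \<in> m_inv M ` Z" unfolding Z_eq x(2) by (metis imageI)
      qed
    qed
  qed
qed

sublocale Cay: connected_graph Cay
  by (rule connected_graph_cayley[OF group_M generating_Z])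

lemma Cay_verts [simp]: "pverts Cay = carrier M"
  by (simp add: cayley_graph_def)

lemma Cay_arcD:
  assumes "(V, W) \<in> parcs Cay"
  obtains x where "x \<in> A" "W = V \<otimes>\<^bsub>M\<^esub> cls [x]" "V \<in> carrier M" "W \<in> carrier M"
proof -
  have VW: "V \<in> carrier M" "W \<in> carrier M" "inv\<^bsub>M\<^esub> V \<otimes>\<^bsub>M\<^esub> W \<in> Z"
    using assms by (auto simp: cayley_graph_def cayley_label_def)
  then obtain x where x: "x \<in> A" "inv\<^bsub>M\<^esub> V \<otimes>\<^bsub>M\<^esub> W = cls [x]" by (auto simp: Z_eq)
  have "V \<otimes>\<^bsub>M\<^esub> (inv\<^bsub>M\<^esub> V \<otimes>\<^bsub>M\<^esub> W) = W" using VW by (simp add: M.m_assoc[symmetric])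
  then show thesis using that x VW by simp
qed

lemma Cay_arcI: "\<lbrakk>V \<in> carrier M; x \<in> A\<rbrakk> \<Longrightarrow> (V, V \<otimes>\<^bsub>M\<^esub> cls [x]) \<in> parcs Cay"
  by (auto simp: cayley_graph_def cayley_label_def M.m_assoc[symmetric] Z_eq)

lemma ex_word_from:
  assumes "U \<in> carrier M" "V \<in> carrier M"
  obtains s where "s \<in> lists A" "V = U \<otimes>\<^bsub>M\<^esub> cls s"
proof -
  have "inv\<^bsub>M\<^esub> U \<otimes>\<^bsub>M\<^esub> V \<in> carrier M" using assms by simp
  then obtain s where s: "s \<in> lists A" "inv\<^bsub>M\<^esub> U \<otimes>\<^bsub>M\<^esub> V = cls s" by (auto simp: carrier_M)
  have "U \<otimes>\<^bsub>M\<^esub> (inv\<^bsub>M\<^esub> U \<otimes>\<^bsub>M\<^esub> V) = V" using assms by (simp add: M.m_assoc[symmetric])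
  then show thesis using that s by simp
qed

lemma translate_eq_iff:
  assumes "U \<in> carrier M" "s \<in> lists A" "t \<in> lists A"
  shows "U \<otimes>\<^bsub>M\<^esub> cls s = U \<otimes>\<^bsub>M\<^esub> cls t \<longleftrightarrow> nf s = nf t"
  using assms cls_eq_iff cong_iff_nf by simp

text \<open>
  A letter lengthens a normal form by at most one, and a nonempty normal form can be shortened by one
  letter; by \<open>gdist_eqI\<close> this characterises the distance.
\<close>

theorem gdist_Cay:
  assumes U: "U \<in> carrier M" and s: "s \<in> lists A"
  shows "gdist Cay U (U \<otimes>\<^bsub>M\<^esub> cls s) = nf_length (nf s)"
proof -
  define d where "d V = nf_length (nf (SOME s. s \<in> lists A \<and> V = U \<otimes>\<^bsub>M\<^esub> cls s))" for V
  have d: "d (U \<otimes>\<^bsub>M\<^esub> cls t) = nf_length (nf t)" if t: "t \<in> lists A" for t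
  proof -
    have "\<exists>s. s \<in> lists A \<and> U \<otimes>\<^bsub>M\<^esub> cls t = U \<otimes>\<^bsub>M\<^esub> cls s" using t by blast
    from someI_ex[OF this]
    have "nf t = nf (SOME s. s \<in> lists A \<and> U \<otimes>\<^bsub>M\<^esub> cls t = U \<otimes>\<^bsub>M\<^esub> cls s)"
      using translate_eq_iff[OF U t] by blast
    then show ?thesis by (simp add: d_def)
  qed
  have root: "U = U \<otimes>\<^bsub>M\<^esub> cls []" using U by (simp flip: one_M)
  have "d (U \<otimes>\<^bsub>M\<^esub> cls s) = gdist Cay U (U \<otimes>\<^bsub>M\<^esub> cls s)"
  proof (rule Cay.gdist_eqI)
    show "d U = 0" using d[of "[]"] root by simp
  next
    fix V W assume "(V, W) \<in> parcs Cay"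
    then obtain x where x: "x \<in> A" "W = V \<otimes>\<^bsub>M\<^esub> cls [x]" "V \<in> carrier M" by (rule Cay_arcD)
    obtain t where t: "t \<in> lists A" "V = U \<otimes>\<^bsub>M\<^esub> cls t" using ex_word_from[OF U x(3)] .
    have W: "W = U \<otimes>\<^bsub>M\<^esub> cls (t @ [x])" using x t U by (simp add: M.m_assoc mult_M)
    obtain u v where uv: "(u, v) \<in> parcs X" "x = L u v" using every_letter[OF x(1)] by blast
    have "nf (t @ [x]) = jump u v (nf t)" using nf_snoc_letter[OF t(1) uv(1)] uv(2) by simp
    then have "nf_length (nf (t @ [x])) \<le> nf_length (nf t) + 1"
      using nf_length_step[OF reduced_run[OF t(1)] uv(1), of "[]"] by simp
    then show "d W \<le> d V + 1" using d[of t] d[of "t @ [x]"] t W x(1) by simp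
  next
    fix V assume V: "V \<in> pverts Cay" "V \<noteq> U"
    then obtain t where t: "t \<in> lists A" "V = U \<otimes>\<^bsub>M\<^esub> cls t" using ex_word_from[OF U] by auto
    have "nf t \<noteq> []" using V(2) t translate_eq_iff[OF U t(1), of "[]"] root by simp
    then obtain t' x where t': "t' \<in> lists A" "x \<in> A" "t' @ [x] \<approx> t"
        "nf_length (nf t) = nf_length (nf t') + 1"
      using ex_nf_predecessor[OF t(1)] by metis
    have "cls t = cls t' \<otimes>\<^bsub>M\<^esub> cls [x]" using t t' cls_eq_iff[of "t' @ [x]" t] by (simp add: mult_M)
    then have "V = (U \<otimes>\<^bsub>M\<^esub> cls t') \<otimes>\<^bsub>M\<^esub> cls [x]" using t t' U by (simp add: M.m_assoc)
    then have "(U \<otimes>\<^bsub>M\<^esub> cls t', V) \<in> parcs Cay" using Cay_arcI[of "U \<otimes>\<^bsub>M\<^esub> cls t'" x] U t' by simp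
    then show "\<exists>W. (W, V) \<in> parcs Cay \<and> d V = d W + 1"
      using d[OF t'(1)] d[OF t(1)] t t' by auto
  qed (use U s in auto)
  then show ?thesis using d[OF s] by simp
qed

lemma jump_Nil_inj:
  assumes "u \<in> pverts X" "y \<in> pverts X" "y' \<in> pverts X" "jump u y [] = jump u y' []"
  shows "y = y'"
  using assms orb_eq_right[of u y y'] by (auto simp: jump_def split: if_splits)

text \<open>
  From left to right, the orbit of \<open>(u, v)\<close> alone is a normal form, and distinct predecessors of \<open>v\<close>
  give distinct predecessors of it.  From right to left, a predecessor of an element is determined by
  the predecessor of \<open>v\<close> that replaces \<open>v\<close> in the last member of the normal form.
\<close>

theorem unique_predecessors_Cay_iff: "unique_predecessors Cay \<longleftrightarrow> unique_predecessors X"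
proof
  assume up: "unique_predecessors Cay"
  show "unique_predecessors X"
    unfolding unique_predecessors_def
  proof (intro ballI allI impI)
    fix u v y y'
    assume u: "u \<in> pverts X" and y: "(y, v) \<in> parcs X" "gdist X u v = gdist X u y + 1"
      and y': "(y', v) \<in> parcs X" "gdist X u v = gdist X u y' + 1"
    have len: "nf_length (jump u z []) = gdist X u z" if "z \<in> pverts X" for z
      using u that by (simp add: jump_def)
    have v: "v \<in> pverts X" using in_arcsD2[OF y(1)] .
    obtain s where s: "s \<in> lists A" "nf s = jump u v []"
      using ex_walk[OF u v] run_walk[of _ "[]"] lbl_in by (metis reduced.simps(1))
    have pred: "\<exists>t\<in>lists A. nf t = jump u z [] \<and> (cls t, cls s) \<in> parcs Cay \<and>
        gdist Cay \<one>\<^bsub>M\<^esub> (cls s) = gdist Cay \<one>\<^bsub>M\<^esub> (cls t) + 1"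
      if z: "(z, v) \<in> parcs X" "gdist X u v = gdist X u z + 1" for z
    proof -
      have zV: "z \<in> pverts X" using in_arcsD1[OF z(1)] .
      obtain t where t: "t \<in> lists A" "nf t = jump u z []"
        using ex_walk[OF u zV] run_walk[of _ "[]"] lbl_in by (metis reduced.simps(1))
      have "nf (t @ [L z v]) = nf s"
        using nf_snoc_letter[OF t(1) z(1)] t(2) s(2) jump_jump[of "[]", OF _ u zV v] by simp
      then have "cls (t @ [L z v]) = cls s"
        using cls_eq_iff cong_iff_nf t(1) s(1) L_in[OF z(1)] by simp
      then have "(cls t, cls s) \<in> parcs Cay"
        using Cay_arcI[of "cls t" "L z v"] t(1) L_in[OF z(1)] by (simp add: mult_M)
      moreover have "gdist Cay \<one>\<^bsub>M\<^esub> (cls s) = gdist Cay \<one>\<^bsub>M\<^esub> (cls t) + 1"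
        using gdist_Cay[of "\<one>\<^bsub>M\<^esub>" s] gdist_Cay[of "\<one>\<^bsub>M\<^esub>" t] s t len v zV z(2) by simp
      ultimately show ?thesis using t by blast
    qed
    obtain t where t: "t \<in> lists A" "nf t = jump u y []" "(cls t, cls s) \<in> parcs Cay"
        "gdist Cay \<one>\<^bsub>M\<^esub> (cls s) = gdist Cay \<one>\<^bsub>M\<^esub> (cls t) + 1" using pred[OF y] by blast
    obtain t' where t': "t' \<in> lists A" "nf t' = jump u y' []" "(cls t', cls s) \<in> parcs Cay"
        "gdist Cay \<one>\<^bsub>M\<^esub> (cls s) = gdist Cay \<one>\<^bsub>M\<^esub> (cls t') + 1" using pred[OF y'] by blast
    have "cls t = cls t'"
      using unique_predecessorsD[OF up _ t(3) t'(3) t(4) t'(4)] by simp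
    then have "nf t = nf t'" using cls_eq_iff cong_iff_nf t(1) t'(1) by simp
    then show "y = y'"
      using jump_Nil_inj[OF u in_arcsD1[OF y(1)] in_arcsD1[OF y'(1)]] t(2) t'(2) by simp
  qed
next
  assume up: "unique_predecessors X"
  show "unique_predecessors Cay"
    unfolding unique_predecessors_def
  proof (intro ballI allI impI)
    fix U V W W'
    assume U: "U \<in> pverts Cay" and W: "(W, V) \<in> parcs Cay" "gdist Cay U V = gdist Cay U W + 1"
      and W': "(W', V) \<in> parcs Cay" "gdist Cay U V = gdist Cay U W' + 1"
    have U': "U \<in> carrier M" using U by simp
    obtain s where s: "s \<in> lists A" "V = U \<otimes>\<^bsub>M\<^esub> cls s"
      using ex_word_from[OF U'] Cay_arcD[OF W(1)] by metis
    have "nf s \<noteq> []" using W(2) gdist_Cay[OF U' s(1)] s(2) by auto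
    then obtain u v w where uv: "u \<in> pverts X" "v \<in> pverts X" "nf s = orb u v # w"
      using nf_top[OF s(1)] by metis
    have pred: "\<exists>t y. t \<in> lists A \<and> Q = U \<otimes>\<^bsub>M\<^esub> cls t \<and> (y, v) \<in> parcs X \<and>
        gdist X u v = gdist X u y + 1 \<and> nf t = jump u y w"
      if Q: "(Q, V) \<in> parcs Cay" "gdist Cay U V = gdist Cay U Q + 1" for Q
    proof -
      obtain x where x: "x \<in> A" "V = Q \<otimes>\<^bsub>M\<^esub> cls [x]" "Q \<in> carrier M" using Cay_arcD[OF Q(1)] by metis
      obtain t where t: "t \<in> lists A" "Q = U \<otimes>\<^bsub>M\<^esub> cls t" using ex_word_from[OF U' x(3)] .
      have "U \<otimes>\<^bsub>M\<^esub> cls (t @ [x]) = U \<otimes>\<^bsub>M\<^esub> cls s" using x t s U' by (simp add: M.m_assoc mult_M)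
      then have nft: "nf (t @ [x]) = nf s" using translate_eq_iff[OF U', of "t @ [x]" s] t(1) x(1) s(1) by simp
      have "nf_length (nf (t @ [x])) = nf_length (nf t) + 1"
        using Q(2) gdist_Cay[OF U' s(1)] gdist_Cay[OF U' t(1)] s t nft by simp
      then obtain y where "(y, v) \<in> parcs X" "gdist X u v = gdist X u y + 1" "nf t = jump u y w"
        using nf_predecessor[OF t(1) x(1) uv(1,2)] nft uv(3) by metis
      then show ?thesis using t by blast
    qed
    obtain t y where t: "t \<in> lists A" "W = U \<otimes>\<^bsub>M\<^esub> cls t" "(y, v) \<in> parcs X"
        "gdist X u v = gdist X u y + 1" "nf t = jump u y w" using pred[OF W] by blast
    obtain t' y' where t': "t' \<in> lists A" "W' = U \<otimes>\<^bsub>M\<^esub> cls t'" "(y', v) \<in> parcs X"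
        "gdist X u v = gdist X u y' + 1" "nf t' = jump u y' w" using pred[OF W'] by blast
    have "y = y'" using unique_predecessorsD[OF up uv(1) t(3) t'(3) t(4) t'(4)] .
    then show "W = W'" using translate_eq_iff[OF U' t(1) t'(1)] t t' by simp
  qed
qed

corollary geodetic_Cay_iff: "geodetic Cay \<longleftrightarrow> geodetic X"
  using unique_predecessors_Cay_iff Cay.geodetic_iff_unique_predecessors
    geodetic_iff_unique_predecessors by simp

end

section \<open>The action on the subdivided Cayley graph\<close>

text \<open>
  Left translation, applied to both descriptions of an interior vertex.
\<close>

primrec sd_act :: "('a, 'b) monoid_scheme \<Rightarrow> 'a \<Rightarrow> 'a sd_vertex \<Rightarrow> 'a sd_vertex" where
  "sd_act G g (Orig h) = Orig (g \<otimes>\<^bsub>G\<^esub> h)"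
| "sd_act G g (Mid P) = Mid ((\<lambda>(h, k, i). (g \<otimes>\<^bsub>G\<^esub> h, g \<otimes>\<^bsub>G\<^esub> k, i)) ` P)"

lemma sd_act_sd_point [simp]:
  "sd_act G g (sd_point m h k i) = sd_point m (g \<otimes>\<^bsub>G\<^esub> h) (g \<otimes>\<^bsub>G\<^esub> k) i"
  by (simp add: sd_point_def)

lemma subdivided_arcE:
  assumes "(p, q) \<in> parcs (subdivided_graph m X)"
  obtains g h k where "(g, h) \<in> parcs X" "k < m" "p = sd_point m g h k" "q = sd_point m g h (Suc k)"
  using assms by (auto simp: subdivided_graph_def)

lemma subdivided_vertE:
  assumes "p \<in> pverts (subdivided_graph m X)"
  obtains g where "g \<in> pverts X" "p = Orig g"
    | g h k where "(g, h) \<in> parcs X" "k \<le> m" "p = sd_point m g h k"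
  using assms by (auto simp: subdivided_graph_def)

lemma edge_word_nth:
  assumes "k < 2 * n + 1"
  shows "edge_word S3 n s ! k = (s, if s \<in> S3 then 2 * n + 1 - k else k + 1)"
  using assms by (auto simp: edge_word_def Let_def rev_nth simp del: upt_Suc)

locale nabla_construction =
  fixes G :: "('a, 'b) monoid_scheme" and S S3 :: "'a set" and r :: "('a \<times> nat) rel" and n :: nat
  assumes group: "group G" and S: "finite_inverse_closed_generating_set G S"
    and r: "linear_order_on (nabla_alphabet S n) r"
begin

abbreviation "m \<equiv> 2 * n + 1"
abbreviation "\<Gamma> \<equiv> cayley_graph G S"
abbreviation "lab \<equiv> nabla_label G S S3 n"

sublocale G: group G by (rule group)

sublocale \<Gamma>: odd_subdivision \<Gamma> m
proof -
  interpret connected_graph \<Gamma> using connected_graph_cayley[OF group S] .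
  show "odd_subdivision \<Gamma> m" by unfold_locales simp
qed

lemma nabla_graph_eq: "nabla_graph G S n = subdivided_graph m \<Gamma>"
  by (simp add: nabla_graph_def)

lemma \<Gamma>_verts [simp]: "pverts \<Gamma> = carrier G"
  by (simp add: cayley_graph_def)

lemma \<Gamma>_arc_iff: "(g, h) \<in> parcs \<Gamma> \<longleftrightarrow> g \<in> carrier G \<and> h \<in> carrier G \<and> inv\<^bsub>G\<^esub> g \<otimes>\<^bsub>G\<^esub> h \<in> S"
  by (auto simp: cayley_graph_def cayley_label_def)

lemma quotient_translate:
  assumes "k \<in> carrier G" "g \<in> carrier G" "h \<in> carrier G"
  shows "inv\<^bsub>G\<^esub> (k \<otimes>\<^bsub>G\<^esub> g) \<otimes>\<^bsub>G\<^esub> (k \<otimes>\<^bsub>G\<^esub> h) = inv\<^bsub>G\<^esub> g \<otimes>\<^bsub>G\<^esub> h"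
proof -
  have "inv\<^bsub>G\<^esub> k \<otimes>\<^bsub>G\<^esub> (k \<otimes>\<^bsub>G\<^esub> h) = h" using assms by (simp flip: G.m_assoc)
  then show ?thesis using assms by (simp add: G.inv_mult_group G.m_assoc)
qed

lemma \<Gamma>_arc_translate: "\<lbrakk>k \<in> carrier G; (g, h) \<in> parcs \<Gamma>\<rbrakk> \<Longrightarrow> (k \<otimes>\<^bsub>G\<^esub> g, k \<otimes>\<^bsub>G\<^esub> h) \<in> parcs \<Gamma>"
  by (simp add: \<Gamma>_arc_iff quotient_translate)

text \<open>
  The letter on an arc shows the generator of the underlying edge, and then the position of the arc.
\<close>

lemma lab_sd_point:
  assumes "(g, h) \<in> parcs \<Gamma>" "k < m"
  shows "lab (sd_point m g h k) (sd_point m g h (Suc k)) =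
    (inv\<^bsub>G\<^esub> g \<otimes>\<^bsub>G\<^esub> h, if inv\<^bsub>G\<^esub> g \<otimes>\<^bsub>G\<^esub> h \<in> S3 then m - k else k + 1)"
proof -
  have \<Gamma>: "pair_bidirected_digraph \<Gamma>" ..
  show ?thesis
    unfolding nabla_label_def sd_label_sd_point[OF \<Gamma> assms] edge_word_nth[OF assms(2)] cayley_label_def ..
qed

sublocale free_labelled_action G "subdivided_graph m \<Gamma>" lab "nabla_alphabet S n" r "sd_act G"
proof
  show "finite (nabla_alphabet S n)"
    using S by (simp add: nabla_alphabet_def finite_inverse_closed_generating_set_def)
  show "linear_order_on (nabla_alphabet S n) r" by (rule r)
  show "lab p q \<in> nabla_alphabet S n" if "(p, q) \<in> parcs (subdivided_graph m \<Gamma>)" for p q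
    using that
  proof (rule subdivided_arcE)
    fix g h k assume e: "(g, h) \<in> parcs \<Gamma>" "k < m" "p = sd_point m g h k" "q = sd_point m g h (Suc k)"
    then show ?thesis using lab_sd_point[OF e(1,2)] by (auto simp: nabla_alphabet_def \<Gamma>_arc_iff)
  qed
next
  fix g p assume g: "g \<in> carrier G" and p: "p \<in> pverts (subdivided_graph m \<Gamma>)"
  show "sd_act G g p \<in> pverts (subdivided_graph m \<Gamma>)"
    using p
  proof (cases rule: subdivided_vertE)
    case (1 h)
    then show ?thesis unfolding 1(2) sd_act.simps \<Gamma>.Orig_vert using g by simp
  next
    case (2 h k i)
    then show ?thesis using \<Gamma>.pt_vert \<Gamma>_arc_translate[OF g] by simp
  qed
  show "g = \<one>\<^bsub>G\<^esub>" if fixed: "sd_act G g p = p"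
    using p
  proof (cases rule: \<Gamma>.vert_cases)
    case (Orig h)
    then show ?thesis using fixed g G.r_cancel_one' by simp
  next
    case (interior h k i)
    have hk: "h \<in> carrier G" "k \<in> carrier G" using interior(1) by (auto simp: \<Gamma>_arc_iff)
    have "sd_point m h k i = sd_point m (g \<otimes>\<^bsub>G\<^esub> h) (g \<otimes>\<^bsub>G\<^esub> k) i" using fixed interior(4) by simp
    then have "h = g \<otimes>\<^bsub>G\<^esub> h \<or> i + i = m"
      using sd_point_eqD[OF \<Gamma>.arc_neq[OF interior(1)]] interior(2,3) by (metis less_imp_le_nat)
    \<comment> \<open>The midpoint of an inverted edge would be fixed, but the number of parts is odd.\<close>
    moreover have "i + i \<noteq> m" by presburger
    ultimately show ?thesis using g hk G.r_cancel_one' by metis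
  qed
next
  fix p assume p: "p \<in> pverts (subdivided_graph m \<Gamma>)"
  show "sd_act G \<one>\<^bsub>G\<^esub> p = p"
    using p by (cases rule: subdivided_vertE) (auto simp: \<Gamma>_arc_iff)
  show "sd_act G (g \<otimes>\<^bsub>G\<^esub> h) p = sd_act G g (sd_act G h p)" if "g \<in> carrier G" "h \<in> carrier G" for g h
    using p that by (cases rule: subdivided_vertE) (auto simp: \<Gamma>_arc_iff G.m_assoc)
next
  fix g p q assume g: "g \<in> carrier G" and "(p, q) \<in> parcs (subdivided_graph m \<Gamma>)"
  then obtain h k i where e: "(h, k) \<in> parcs \<Gamma>" "i < m" "p = sd_point m h k i" "q = sd_point m h k (Suc i)"
    using subdivided_arcE by metis
  note e' = \<Gamma>_arc_translate[OF g e(1)]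
  show "(sd_act G g p, sd_act G g q) \<in> parcs (subdivided_graph m \<Gamma>)"
    using \<Gamma>.pt_arc[OF e' e(2)] e(3,4) by simp
  have "inv\<^bsub>G\<^esub> (g \<otimes>\<^bsub>G\<^esub> h) \<otimes>\<^bsub>G\<^esub> (g \<otimes>\<^bsub>G\<^esub> k) = inv\<^bsub>G\<^esub> h \<otimes>\<^bsub>G\<^esub> k"
    using quotient_translate g e(1) \<Gamma>_arc_iff by blast
  then show "lab (sd_act G g p) (sd_act G g q) = lab p q"
    using lab_sd_point[OF e(1,2)] lab_sd_point[OF e' e(2)] e(3,4) by simp
next
  fix p q p' q'
  assume "(p, q) \<in> parcs (subdivided_graph m \<Gamma>)" "(p', q') \<in> parcs (subdivided_graph m \<Gamma>)"
    and same: "lab p q = lab p' q'"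
  then obtain h k i h' k' i' where
      e: "(h, k) \<in> parcs \<Gamma>" "i < m" "p = sd_point m h k i" "q = sd_point m h k (Suc i)" and
      e': "(h', k') \<in> parcs \<Gamma>" "i' < m" "p' = sd_point m h' k' i'" "q' = sd_point m h' k' (Suc i')"
    using subdivided_arcE by metis
  have V: "h \<in> carrier G" "k \<in> carrier G" "h' \<in> carrier G" "k' \<in> carrier G"
    using e(1) e'(1) by (auto simp: \<Gamma>_arc_iff)
  have lab_eq: "inv\<^bsub>G\<^esub> h \<otimes>\<^bsub>G\<^esub> k = inv\<^bsub>G\<^esub> h' \<otimes>\<^bsub>G\<^esub> k'" "i = i'"
    using same lab_sd_point[OF e(1,2)] lab_sd_point[OF e'(1,2)] e e' by (auto split: if_splits)
  \<comment> \<open>Equal letters sit at the same position of edges with the same generator; translate one initial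
      vertex to the other.\<close>
  let ?g = "h' \<otimes>\<^bsub>G\<^esub> inv\<^bsub>G\<^esub> h"
  have "?g \<otimes>\<^bsub>G\<^esub> h = h'" using V by (simp add: G.m_assoc)
  moreover have "?g \<otimes>\<^bsub>G\<^esub> k = h' \<otimes>\<^bsub>G\<^esub> (inv\<^bsub>G\<^esub> h \<otimes>\<^bsub>G\<^esub> k)" using V by (simp add: G.m_assoc)
  then have "?g \<otimes>\<^bsub>G\<^esub> k = k'" using V lab_eq(1) by (simp add: G.m_assoc[symmetric])
  ultimately show "\<exists>g\<in>carrier G. p' = sd_act G g p \<and> q' = sd_act G g q"
    using e e' lab_eq(2) V by (intro bexI[of _ ?g]) simp_all
next
  fix x assume "x \<in> nabla_alphabet S n"
  then obtain s j where x: "x = (s, j)" "s \<in> S" "1 \<le> j" "j \<le> m" by (auto simp: nabla_alphabet_def)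
  have s: "s \<in> carrier G" using x(2) S by (auto simp: finite_inverse_closed_generating_set_def)
  have arc: "(\<one>\<^bsub>G\<^esub>, s) \<in> parcs \<Gamma>" using s x(2) by (simp add: \<Gamma>_arc_iff)
  \<comment> \<open>Positions count from 0 along the edge from the identity, indices of letters from 1, and edges of
      generators in \<open>S3\<close> are read backwards.\<close>
  define k where "k = (if s \<in> S3 then m - j else j - 1)"
  have k: "k < m" using x(3,4) by (auto simp: k_def)
  have "lab (sd_point m \<one>\<^bsub>G\<^esub> s k) (sd_point m \<one>\<^bsub>G\<^esub> s (Suc k)) = x"
    using lab_sd_point[OF arc k] s x by (auto simp: k_def)
  then show "\<exists>u v. (u, v) \<in> parcs (subdivided_graph m \<Gamma>) \<and> lab u v = x"
    using \<Gamma>.pt_arc[OF arc k] by blast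
qed

lemma nabla_eq: "nabla G S S3 r n = (nabla_alphabet S n, circuit_rules (subdivided_graph m \<Gamma>) lab r)"
  by (simp add: nabla_def nabla_rules_eq nabla_graph_eq)

end

theorem theorem2:
  fixes G :: "('a, 'b) monoid_scheme" and S S2 S3 :: "'a set"
    and r :: "('a \<times> nat) rel" and n :: nat
  assumes "group G"
    and "finite_inverse_closed_generating_set G S"
    and "inverse_pair_partition G S S2 S3"
    and "linear_order_on (nabla_alphabet S n) r"
  shows "geodetic (cayley_graph G S) \<longleftrightarrow>
    geodetic (cayley_graph (rewriting_monoid (nabla G S S3 r n))
                           (rewriting_letters (nabla G S S3 r n)))"
proof -
  interpret nabla_construction G S S3 r n
    by (rule nabla_construction.intro) fact+
  have "geodetic (cayley_graph G S) \<longleftrightarrow> geodetic (subdivided_graph m \<Gamma>)"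
    using \<Gamma>.unique_predecessors_subdivided_iff \<Gamma>.geodetic_iff_unique_predecessors
      \<Gamma>.Y.geodetic_iff_unique_predecessors by simp
  then show ?thesis using geodetic_Cay_iff by (simp add: nabla_eq)
qed

end
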